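(* Let $m$ be a non-negative integer and $\alpha\in\mathbb{C}$. For $z\in(1,\infty)$ and $\xi\in(0,\infty)$, $$P_{-\frac12+\alpha}^{\pm(\frac12+m)}(z)=\sqrt{\frac2\pi}\;m!\left[(-1)^m\,\Big|\,\frac{(-1)^{m+1}}{(\alpha-m)_{2m+1}}\right]_\pm(z^2-1)^{-1/4}\left\{\left(z+\sqrt{z^2-1}\right)^{-\alpha}P_m^{(\alpha,-\alpha)}\!\left(\frac z{\sqrt{z^2-1}}\right)\right\}_{\alpha,\pm},$$ $$P_{-\frac12+\alpha}^{\pm(\frac12+m)}(\cosh\xi)=\sqrt{\frac2\pi}\;m!\left[(-1)^m\,\Big|\,\frac{(-1)^{m+1}}{(\alpha-m)_{2m+1}}\right]_\pm(\sinh\xi)^{-1/2}\left\{{\rm e}^{-\alpha\xi}\,P_m^{(\alpha,-\alpha)}(\coth\xi)\right\}_{\alpha,\pm},$$ where $P_\nu^\mu$ is the associated Legendre function of the first kind, $P_m^{(\alpha,\beta)}$ is the Jacobi polynomial, $[A|B]_\pm$ signifies $A$ in the $+$ case and $B$ in the $-$ case, and $\{C\}_{\alpha,\pm}:=\frac12[C(\alpha)\pm C(-\alpha)]$ is the even ($+$) or odd ($-$) part of $C$ under $\alpha\mapsto-\alpha$. It is understood in the $-$ case that when $\alpha\in\{-m,\dots,m\}$ and there is an apparent division by zero, each right-hand side requires the taking of a limit in $\alpha$.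
   Context: For $z>1$, $P_\nu^\mu(z)=\frac1{\Gamma(1-\mu)}\left(\frac{z+1}{z-1}\right)^{\mu/2}{}_2F_1\!\left(-\nu,\nu+1;1-\mu;\frac{1-z}2\right)$, with ${}_2F_1$ the (analytically continued) Gauss function. $(\alpha-m)_{2m+1}=(\alpha-m)(\alpha-m+1)\cdots(\alpha+m)$. The Jacobi polynomials, for arbitrary complex $\alpha,\beta$, are given by $P_n^{(\alpha,\beta)}(z)=\frac{(-1)^n}{2^nn!}(1-z)^{-\alpha}(1+z)^{-\beta}\frac{{\rm d}^n}{{\rm d}z^n}\left[(1-z)^{\alpha+n}(1+z)^{\beta+n}\right]$. *)

theory Defs
  imports "HOL-Complex_Analysis.Complex_Analysis"
begin

definition gauss_domain :: "complex set" where
  "gauss_domain = - (complex_of_real ` {1..})"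

text \<open>
  The value at \<open>z\<close> of the principal branch of the Gauss hypergeometric function: the value of the
  (unique) holomorphic function on the plane cut along \<open>[1,\<infinity>)\<close> that is given on the unit disc by
  the hypergeometric series. Intended for \<open>c\<close> not a non-positive integer.
\<close>
definition gauss_2F1 :: "complex \<Rightarrow> complex \<Rightarrow> complex \<Rightarrow> complex \<Rightarrow> complex" where
  "gauss_2F1 a b c z =
     (THE w. \<exists>F. F holomorphic_on gauss_domain \<and>
        (\<forall>u\<in>ball 0 1. F u = eval_fps (fps_hypergeo [a, b] [c] 1) u) \<and> w = F z)"

text \<open>
  \<open>legendre_P \<nu> \<mu> z\<close> has degree \<open>\<nu>\<close> (the subscript) and order \<open>\<mu>\<close> (the superscript); it is
  intended for \<open>z > 1\<close> and \<open>\<mu>\<close> not a positive integer.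
\<close>
definition legendre_P :: "complex \<Rightarrow> complex \<Rightarrow> real \<Rightarrow> complex" where
  "legendre_P \<nu> \<mu> z =
     1 / Gamma (1 - \<mu>) * of_real ((z + 1) / (z - 1)) powr (\<mu> / 2)
       * gauss_2F1 (- \<nu>) (\<nu> + 1) (1 - \<mu>) (of_real ((1 - z) / 2))"

definition jacobi_domain :: "complex set" where
  "jacobi_domain = - (complex_of_real ` ({..-1} \<union> {1..}))"

text \<open>
  The Jacobi polynomial \<open>P\<^sub>n\<^sup>(\<^sup>\<alpha>\<^sup>,\<^sup>\<beta>\<^sup>)\<close> is the polynomial given by Rodrigues' formula. The formula itself is
  read on the doubly cut plane, where the principal powers of \<open>1 - z\<close> and \<open>1 + z\<close> are holomorphic;
  being a polynomial, the result can then be evaluated on the cuts as well.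
\<close>
definition jacobi_poly :: "nat \<Rightarrow> complex \<Rightarrow> complex \<Rightarrow> complex poly" where
  "jacobi_poly n \<alpha> \<beta> =
     (THE p. \<forall>z\<in>jacobi_domain. poly p z =
        (-1) ^ n / (2 ^ n * fact n) * (1 - z) powr (- \<alpha>) * (1 + z) powr (- \<beta>)
          * (deriv ^^ n) (\<lambda>w. (1 - w) powr (\<alpha> + of_nat n) * (1 + w) powr (\<beta> + of_nat n)) z)"

definition even_part :: "(complex \<Rightarrow> complex) \<Rightarrow> complex \<Rightarrow> complex" where
  "even_part C \<alpha> = 1 / 2 * (C \<alpha> + C (- \<alpha>))"

definition odd_part :: "(complex \<Rightarrow> complex) \<Rightarrow> complex \<Rightarrow> complex" where
  "odd_part C \<alpha> = 1 / 2 * (C \<alpha> - C (- \<alpha>))"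

lemma gauss_domain_open: "open gauss_domain"
proof -
  have "gauss_domain = (\<lambda>z. 1 - z) -` (- \<real>\<^sub>\<le>\<^sub>0)"
    by (force simp: gauss_domain_def complex_nonpos_Reals_iff complex_eq_iff image_iff)
  moreover have "open ((\<lambda>z::complex. 1 - z) -` (- \<real>\<^sub>\<le>\<^sub>0))"
    by (intro open_vimage open_Compl closed_nonpos_Reals_complex continuous_intros)
  ultimately show ?thesis by simp
qed

lemma gauss_domain_connected: "connected gauss_domain"
proof -
  have "closed_segment 0 z \<subseteq> gauss_domain" if z: "z \<in> gauss_domain" for z
  proof
    fix w assume "w \<in> closed_segment 0 z"
    then obtain t where t: "0 \<le> t" "t \<le> 1" "w = of_real t * z"
      by (auto simp: in_segment scaleR_conv_of_real)
    show "w \<in> gauss_domain"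
    proof (rule ccontr)
      assume "w \<notin> gauss_domain"
      then obtain x where x: "x \<ge> 1" "of_real t * z = of_real x"
        using t by (auto simp: gauss_domain_def)
      hence "t > 0" using t by (cases "t = 0") auto
      hence "z = of_real (x / t)" using x by (simp add: field_simps)
      moreover have "x / t \<ge> 1" using \<open>t > 0\<close> t x by (simp add: field_simps)
      ultimately show False using z unfolding gauss_domain_def by blast
    qed
  qed
  moreover have "0 \<in> gauss_domain" by (auto simp: gauss_domain_def)
  ultimately have "starlike gauss_domain" by (auto simp: starlike_def)
  thus ?thesis by (rule starlike_imp_connected)
qed

lemma gauss_domain_ball: "ball 0 1 \<subseteq> gauss_domain"
  by (auto simp: gauss_domain_def)

lemma gauss_2F1_eqI:
  assumes F: "F holomorphic_on gauss_domain"
    and eq: "\<And>u. u \<in> ball 0 1 \<Longrightarrow> F u = eval_fps (fps_hypergeo [a, b] [c] 1) u"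
    and z: "z \<in> gauss_domain"
  shows "gauss_2F1 a b c z = F z"
  unfolding gauss_2F1_def
proof (rule the_equality)
  show "\<exists>F'. F' holomorphic_on gauss_domain \<and>
      (\<forall>u\<in>ball 0 1. F' u = eval_fps (fps_hypergeo [a, b] [c] 1) u) \<and> F z = F' z"
    using F eq by blast
next
  fix w assume "\<exists>F'. F' holomorphic_on gauss_domain \<and>
      (\<forall>u\<in>ball 0 1. F' u = eval_fps (fps_hypergeo [a, b] [c] 1) u) \<and> w = F' z"
  then obtain G where G: "G holomorphic_on gauss_domain"
    "\<And>u. u \<in> ball 0 1 \<Longrightarrow> G u = eval_fps (fps_hypergeo [a, b] [c] 1) u" "w = G z" by blast
  have "G z = F z"
    by (rule analytic_continuation_open[of "ball 0 1" gauss_domain G F])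
       (use G F eq z gauss_domain_ball gauss_domain_open gauss_domain_connected in auto)
  thus "w = F z" using G by simp
qed

lemma jacobi_poly_eqI:
  assumes "\<And>z. z \<in> jacobi_domain \<Longrightarrow> poly p z =
        (-1) ^ n / (2 ^ n * fact n) * (1 - z) powr (- \<alpha>) * (1 + z) powr (- \<beta>)
          * (deriv ^^ n) (\<lambda>w. (1 - w) powr (\<alpha> + of_nat n) * (1 + w) powr (\<beta> + of_nat n)) z"
  shows "jacobi_poly n \<alpha> \<beta> = p"
  unfolding jacobi_poly_def
proof (rule the_equality)
  fix q :: "complex poly"
  assume "\<forall>z\<in>jacobi_domain. poly q z =
        (-1) ^ n / (2 ^ n * fact n) * (1 - z) powr (- \<alpha>) * (1 + z) powr (- \<beta>)
          * (deriv ^^ n) (\<lambda>w. (1 - w) powr (\<alpha> + of_nat n) * (1 + w) powr (\<beta> + of_nat n)) z"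
  with assms have eq: "poly (q - p) z = 0" if "z \<in> jacobi_domain" for z
    using that by simp
  have "ball 0 1 \<subseteq> jacobi_domain" by (auto simp: jacobi_domain_def)
  with eq have "ball 0 1 \<subseteq> {z. poly (q - p) z = 0}" by auto
  moreover have "infinite (ball (0::complex) 1)"
    using uncountable_ball[of 1 "0::complex"] countable_finite by auto
  ultimately have "infinite {z. poly (q - p) z = 0}" using finite_subset by blast
  hence "q - p = 0" using poly_roots_finite by blast
  thus "q = p" by simp
qed (use assms in auto)

end

theory Submission
  imports Defs
begin

text \<open>
  With \<open>z = cosh \<xi>\<close> both functions are elementary factors times \<open>F(c; u)\<close>, the Gauss function with
  parameters \<open>1/2 - \<alpha>\<close>, \<open>1/2 + \<alpha>\<close>, \<open>c\<close> at \<open>u = - sinh\<^sup>2(\<xi>/2)\<close>, where \<open>c = 1/2 - m\<close> in the \<open>+\<close> case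
  and \<open>c = 3/2 + m\<close> in the \<open>-\<close> case. For \<open>c = 1/2\<close> it is \<open>cosh(\<alpha>\<xi>) / cosh(\<xi>/2)\<close>, which continues
  holomorphically to the cut plane. The first order relations between \<open>F(c; u)\<close> and \<open>F(c \<plusminus> 1; u)\<close>
  become, in the variable \<open>\<xi>\<close>, the recurrence
  \<open>C\<^sub>m' = (m + 1) (coth \<xi> C\<^sub>m - C\<^sub>m\<^sub>+\<^sub>1)\<close> satisfied by \<open>C\<^sub>m(\<xi>) = e\<^sup>-\<^sup>\<alpha>\<^sup>\<xi> P\<^sub>m\<^sup>(\<^sup>\<alpha>\<^sup>,\<^sup>-\<^sup>\<alpha>\<^sup>)(coth \<xi>)\<close>, hence also by its even
  and odd parts in \<open>\<alpha>\<close>; both closed forms follow by induction on \<open>m\<close>. Raising \<open>c\<close> in this way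
  divides by \<open>k\<^sup>2 - \<alpha>\<^sup>2\<close>. An integral representation raises \<open>c\<close> without any division and shows that
  \<open>F(3/2 + m; u)\<close> is continuous in \<open>\<alpha>\<close>, which gives the limits at \<open>\<alpha> \<in> {-m..m}\<close>.
\<close>

unbundle no vec_syntax

subsection \<open>Holomorphic continuations of the Gauss series\<close>

text \<open>The series condition is a Taylor expansion at 0 rather than an equality on the disc, so
  that differential operators can be checked coefficient by coefficient; \<open>gauss_2F1_eq\<close>
  recovers the values on the cut plane.\<close>

definition gauss_continuation :: "complex \<Rightarrow> complex \<Rightarrow> complex \<Rightarrow> (complex \<Rightarrow> complex) \<Rightarrow> bool" where
  "gauss_continuation a b c F \<longleftrightarrow>
     F holomorphic_on gauss_domain \<and> F has_fps_expansion fps_hypergeo [a, b] [c] 1"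

lemma zero_in_gauss_domain: "0 \<in> gauss_domain"
  by (auto simp: gauss_domain_def)

lemma gauss_2F1_eq:
  assumes "gauss_continuation a b c F" "z \<in> gauss_domain"
  shows "gauss_2F1 a b c z = F z"
proof (rule gauss_2F1_eqI)
  show hol: "F holomorphic_on gauss_domain"
    using assms by (simp add: gauss_continuation_def)
  show "F u = eval_fps (fps_hypergeo [a, b] [c] 1) u" if "u \<in> ball 0 1" for u
    using has_fps_expansion_imp_eval_fps_eq[of F "fps_hypergeo [a, b] [c] 1" u 1] that assms(1)
      holomorphic_on_subset[OF hol gauss_domain_ball]
    by (simp add: gauss_continuation_def)
qed fact

lemma add_of_nat_neq_0_if_notin_nonpos_Ints:
  fixes c :: complex
  assumes "c \<notin> \<int>\<^sub>\<le>\<^sub>0"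
  shows "c + of_nat n \<noteq> 0"
  using assms by (metis add.commute add.inverse_unique minus_of_nat_in_nonpos_Ints)

section \<open>Coefficient identities and the first order relations in \<open>c\<close>\<close>

lemma fps_hypergeo2_rec:
  fixes a b c :: complex
  assumes "c \<notin> \<int>\<^sub>\<le>\<^sub>0"
  shows "of_nat (Suc n) * (c + of_nat n) * fps_hypergeo [a, b] [c] 1 $ Suc n =
           (a + of_nat n) * (b + of_nat n) * fps_hypergeo [a, b] [c] 1 $ n"
proof -
  have "(c + of_nat n) * of_nat (Suc n) \<noteq> 0"
    using add_of_nat_neq_0_if_notin_nonpos_Ints[OF assms, of n] by (simp del: of_nat_Suc)
  thus ?thesis
    by (simp add: fps_hypergeo_rec mult_ac del: fps_hypergeo_nth of_nat_Suc)
qed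

text \<open>Serves to recognise a Gauss series from a differential equation. The recurrence
  determines every coefficient because \<open>c + n\<close> never vanishes.\<close>

lemma fps_hypergeo2_unique:
  fixes a b c :: complex
  assumes c: "c \<notin> \<int>\<^sub>\<le>\<^sub>0"
    and rec: "\<And>n. of_nat (Suc n) * (c + of_nat n) * G $ Suc n = (a + of_nat n) * (b + of_nat n) * G $ n"
    and "G $ 0 = 1"
  shows "G = fps_hypergeo [a, b] [c] 1"
proof (rule fps_ext)
  fix n show "G $ n = fps_hypergeo [a, b] [c] 1 $ n"
  proof (induction n)
    case 0 thus ?case using assms by (simp del: fps_hypergeo_nth)
  next
    case (Suc n)
    have "c + of_nat n \<noteq> 0"
      using c by (rule add_of_nat_neq_0_if_notin_nonpos_Ints)
    moreover have "of_nat (Suc n) * (c + of_nat n) * G $ Suc n =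
        of_nat (Suc n) * (c + of_nat n) * fps_hypergeo [a, b] [c] 1 $ Suc n"
      by (simp only: rec fps_hypergeo2_rec[OF c] Suc)
    ultimately show ?case by (simp del: fps_hypergeo_nth of_nat_Suc)
  qed
qed

lemma fps_hypergeo2_shift:
  fixes a b c :: complex
  assumes "c \<notin> \<int>\<^sub>\<le>\<^sub>0"
  shows "(c + of_nat n) * fps_hypergeo [a, b] [c + 1] 1 $ n = c * fps_hypergeo [a, b] [c] 1 $ n"
proof -
  have "c * pochhammer (c + 1) n = pochhammer c n * (c + of_nat n)"
    by (metis mult.commute pochhammer_Suc pochhammer_rec)
  moreover have "c \<noteq> 0" "pochhammer c n \<noteq> 0" "c + of_nat n \<noteq> 0"
    using assms pochhammer_eq_0_imp_nonpos_Int add_of_nat_neq_0_if_notin_nonpos_Ints by auto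
  moreover from this have "pochhammer (c + 1) n \<noteq> 0"
    using calculation by auto
  ultimately show ?thesis
    by (simp add: divide_simps)
qed

text \<open>The operator multiplies the \<open>n\<close>-th coefficient by
  \<open>(c + n) / c\<close>, which by \<open>fps_hypergeo2_shift\<close> is the passage from
  \<open>c + 1\<close> to \<open>c\<close>.\<close>

lemma gauss_continuation_lower:
  assumes F: "gauss_continuation a b (c + 1) F" and c: "c \<notin> \<int>\<^sub>\<le>\<^sub>0"
  shows "gauss_continuation a b c (\<lambda>u. F u + 1 / c * (u * deriv F u))"
  unfolding gauss_continuation_def
proof
  show "(\<lambda>u. F u + 1 / c * (u * deriv F u)) holomorphic_on gauss_domain"
    using F gauss_domain_open by (auto simp: gauss_continuation_def intro!: holomorphic_intros)
  let ?h = "fps_hypergeo [a, b] [c + 1] 1"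
  have "(\<lambda>u. F u + 1 / c * (u * deriv F u)) has_fps_expansion
      ?h + fps_const (1 / c) * (fps_X * fps_deriv ?h)"
    using F by (intro fps_expansion_intros) (auto simp: gauss_continuation_def)
  moreover have "?h + fps_const (1 / c) * (fps_X * fps_deriv ?h) = fps_hypergeo [a, b] [c] 1"
  proof (rule fps_ext)
    fix n
    have [simp]: "c \<noteq> 0" using c by auto
    show "(?h + fps_const (1 / c) * (fps_X * fps_deriv ?h)) $ n = fps_hypergeo [a, b] [c] 1 $ n"
      using fps_hypergeo2_shift[OF c, of n a b]
      by (cases n) (simp_all add: field_simps del: fps_hypergeo_nth)
  qed
  ultimately show "(\<lambda>u. F u + 1 / c * (u * deriv F u)) has_fps_expansion fps_hypergeo [a, b] [c] 1"
    by simp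
qed

text \<open>On coefficients this rests on
  \<open>(a + n) (b + n) - (c + n) (n + a + b - c) = (c - a) (c - b)\<close>, whose right-hand side
  is independent of \<open>n\<close>. The assumption \<open>ne\<close> allows division by that
  constant.\<close>

lemma gauss_continuation_raise:
  assumes F: "gauss_continuation a b c F" and c: "c \<notin> \<int>\<^sub>\<le>\<^sub>0" and ne: "(c - a) * (c - b) \<noteq> 0"
  shows "gauss_continuation a b (c + 1)
           (\<lambda>u. c / ((c - a) * (c - b)) * ((1 - u) * deriv F u - (a + b - c) * F u))"
    (is "gauss_continuation _ _ _ ?G")
  unfolding gauss_continuation_def
proof
  show "?G holomorphic_on gauss_domain"
    using F gauss_domain_open by (auto simp: gauss_continuation_def intro!: holomorphic_intros)
  let ?h = "fps_hypergeo [a, b] [c] 1"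
  let ?g = "fps_const (c / ((c - a) * (c - b))) * ((1 - fps_X) * fps_deriv ?h - fps_const (a + b - c) * ?h)"
  have "?G has_fps_expansion ?g"
    using F by (intro fps_expansion_intros) (auto simp: gauss_continuation_def)
  moreover have "?g = fps_hypergeo [a, b] [c + 1] 1"
  proof (rule fps_ext)
    fix n
    have cn: "c + of_nat n \<noteq> 0"
      using c by (rule add_of_nat_neq_0_if_notin_nonpos_Ints)
    define x where "x = ?h $ n"
    \<comment> \<open>This is the \<open>n\<close>-th coefficient of the derivative of the
      series.\<close>
    define y where "y = of_nat (Suc n) * ?h $ Suc n"
    have "((1 - fps_X) * fps_deriv ?h - fps_const (a + b - c) * ?h) $ n
        = y - of_nat n * x - (a + b - c) * x"
      by (cases n) (simp_all add: x_def y_def ring_distribs del: fps_hypergeo_nth of_nat_Suc)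
    moreover have "(c + of_nat n) * y = (a + of_nat n) * (b + of_nat n) * x"
      using fps_hypergeo2_rec[OF c, of n a b] by (simp add: x_def y_def mult_ac del: fps_hypergeo_nth of_nat_Suc)
    hence "(c + of_nat n) * (y - of_nat n * x - (a + b - c) * x) = (c - a) * (c - b) * x"
      by algebra
    moreover have "(c + of_nat n) * fps_hypergeo [a, b] [c + 1] 1 $ n = c * x"
      using fps_hypergeo2_shift[OF c, of n a b] by (simp add: x_def)
    ultimately have "(c + of_nat n) * ((c - a) * (c - b)) * ?g $ n
        = (c + of_nat n) * ((c - a) * (c - b)) * fps_hypergeo [a, b] [c + 1] 1 $ n"
      using ne by (simp del: fps_hypergeo_nth) algebra
    thus "?g $ n = fps_hypergeo [a, b] [c + 1] 1 $ n"
      using cn ne by (simp del: fps_hypergeo_nth)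
  qed
  ultimately show "?G has_fps_expansion fps_hypergeo [a, b] [c + 1] 1"
    by simp
qed

section \<open>The Euler integral: raising \<open>c\<close> without division\<close>

text \<open>
  This is \<open>c \<integral> s\<^sup>c\<^sup>-\<^sup>1 F(s u) ds\<close> over \<open>[0,1]\<close> with \<open>c = k + 1/2\<close> and \<open>s = t\<^sup>2\<close>; the substitution makes the
  integrand continuous also for \<open>k = 0\<close>.
\<close>

definition euler_integral :: "nat \<Rightarrow> (complex \<Rightarrow> complex) \<Rightarrow> complex \<Rightarrow> complex" where
  "euler_integral k F u =
     of_nat (2 * k + 1) * integral {0..1} (\<lambda>t::real. of_real t ^ (2 * k) * F (of_real t ^ 2 * u))"

lemma gauss_domain_scale:
  assumes "u \<in> gauss_domain" "0 \<le> t" "t \<le> 1"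
  shows "of_real t * u \<in> gauss_domain"
  unfolding gauss_domain_def
proof
  assume "of_real t * u \<in> complex_of_real ` {1..}"
  then obtain x where x: "x \<ge> 1" "of_real t * u = of_real x" by auto
  hence "t > 0" using assms by (cases "t = 0") auto
  hence "u = of_real (x / t)" using x by (simp add: field_simps)
  moreover have "x / t \<ge> 1" using \<open>t > 0\<close> assms x by (simp add: field_simps)
  ultimately show False using assms unfolding gauss_domain_def by blast
qed

lemma gauss_domain_scale_power2:
  assumes "u \<in> gauss_domain" "t \<in> {0..1}"
  shows "(of_real t)\<^sup>2 * u \<in> gauss_domain"
  using gauss_domain_scale[of u "t\<^sup>2"] assms by (auto simp: power_le_one)

text \<open>Differentiation under the integral sign. The points \<open>t^2 v\<close> stay in the cut
  plane because it is star-shaped about 0, and a ball around \<open>u\<close> serves as the convex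
  set of parameters.\<close>

lemma has_field_derivative_euler_integral:
  assumes F: "F holomorphic_on gauss_domain" and u: "u \<in> gauss_domain"
  shows "(euler_integral k F has_field_derivative
           of_nat (2 * k + 1) *
             integral {0..1} (\<lambda>t. of_real t ^ (2 * k + 2) * deriv F (of_real t ^ 2 * u))) (at u)"
proof -
  obtain r where r: "r > 0" "ball u r \<subseteq> gauss_domain"
    using gauss_domain_open u openE by blast
  have cont: "continuous_on gauss_domain F" "continuous_on gauss_domain (deriv F)"
    using F gauss_domain_open by (auto intro!: holomorphic_on_imp_continuous_on holomorphic_deriv)
  have sub: "(of_real t)\<^sup>2 * v \<in> gauss_domain" if "v \<in> ball u r" "t \<in> {0..1}" for t :: real and v
    using gauss_domain_scale_power2 that r by blast
  have "((\<lambda>v. integral (cbox 0 1) (\<lambda>t::real. of_real t ^ (2 * k) * F (of_real t ^ 2 * v)))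
      has_field_derivative
      integral (cbox 0 1) (\<lambda>t. of_real t ^ (2 * k + 2) * deriv F (of_real t ^ 2 * u)))
      (at u within ball u r)"
  proof (rule leibniz_rule_field_derivative[where
        fx = "\<lambda>v t. of_real t ^ (2 * k + 2) * deriv F (of_real t ^ 2 * v)"])
    fix v and t :: real assume v: "v \<in> ball u r" and t: "t \<in> cbox 0 1"
    have "(F has_field_derivative deriv F (of_real t ^ 2 * v)) (at (of_real t ^ 2 * v))"
      using F gauss_domain_open sub[of v t] v t by (intro holomorphic_derivI) auto
    moreover have "((\<lambda>v. of_real t ^ 2 * v) has_field_derivative of_real t ^ 2) (at v within ball u r)"
      by (auto intro!: derivative_eq_intros)
    ultimately have "((\<lambda>v. F (of_real t ^ 2 * v)) has_field_derivative
        deriv F (of_real t ^ 2 * v) * of_real t ^ 2) (at v within ball u r)"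
      by (rule DERIV_chain2)
    from DERIV_cmult[OF this, of "of_real t ^ (2 * k)"]
    show "((\<lambda>v. of_real t ^ (2 * k) * F (of_real t ^ 2 * v)) has_field_derivative
        of_real t ^ (2 * k + 2) * deriv F (of_real t ^ 2 * v)) (at v within ball u r)"
      by (simp add: mult_ac power2_eq_square)
  next
    fix v assume "v \<in> ball u r"
    thus "(\<lambda>t::real. of_real t ^ (2 * k) * F (of_real t ^ 2 * v)) integrable_on cbox 0 1"
      using sub by (intro integrable_continuous continuous_intros continuous_on_compose2[OF cont(1)]) auto
  next
    show "continuous_on (ball u r \<times> cbox 0 1)
        (\<lambda>(v, t::real). of_real t ^ (2 * k + 2) * deriv F (of_real t ^ 2 * v))"
      unfolding case_prod_unfold using sub
      by (intro continuous_intros continuous_on_compose2[OF cont(2)]) auto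
  qed (use r in auto)
  hence "((\<lambda>v. integral (cbox 0 1) (\<lambda>t::real. of_real t ^ (2 * k) * F (of_real t ^ 2 * v)))
      has_field_derivative
      integral (cbox 0 1) (\<lambda>t. of_real t ^ (2 * k + 2) * deriv F (of_real t ^ 2 * u))) (at u)"
    using r by (simp add: at_within_open[of u "ball u r"])
  from DERIV_cmult[OF this, of "of_nat (2 * k + 1)"] show ?thesis
    unfolding euler_integral_def[abs_def] by simp
qed

lemma holomorphic_on_euler_integral:
  assumes "F holomorphic_on gauss_domain"
  shows "euler_integral k F holomorphic_on gauss_domain"
  using has_field_derivative_euler_integral[OF assms] gauss_domain_open
  by (auto simp: holomorphic_on_open)

text \<open>Integrate the \<open>t\<close>-derivative of \<open>t^(2k+1) F(t^2 u)\<close> over the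
  unit interval. With \<open>c = k + 1/2\<close> the equation says that the operator of
  \<open>gauss_continuation_lower\<close> sends the integral back to \<open>F\<close>.\<close>

lemma euler_integral_ode:
  assumes F: "F holomorphic_on gauss_domain" and u: "u \<in> gauss_domain"
  shows "of_nat (2 * k + 1) * euler_integral k F u + 2 * u * deriv (euler_integral k F) u =
           of_nat (2 * k + 1) * F u"
proof -
  have cont: "continuous_on gauss_domain F" "continuous_on gauss_domain (deriv F)"
    using F gauss_domain_open by (auto intro!: holomorphic_on_imp_continuous_on holomorphic_deriv)
  let ?f = "\<lambda>t::real. of_real t ^ (2 * k) * F (of_real t ^ 2 * u)"
  let ?g = "\<lambda>t::real. of_real t ^ (2 * k + 2) * deriv F (of_real t ^ 2 * u)"
  have sub: "(of_real t)\<^sup>2 * u \<in> gauss_domain" if "t \<in> {0..1}" for t :: real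
    using gauss_domain_scale_power2 that u by blast
  have int: "?f integrable_on {0..1}" "?g integrable_on {0..1}"
    using sub by (intro integrable_continuous_interval continuous_intros
        continuous_on_compose2[OF cont(1)] continuous_on_compose2[OF cont(2)]; auto)+
  have FT: "((\<lambda>t. of_nat (2 * k + 1) * ?f t + 2 * u * ?g t) has_integral
      of_real 1 ^ (2 * k + 1) * F (of_real 1 ^ 2 * u) - of_real 0 ^ (2 * k + 1) * F (of_real 0 ^ 2 * u)) {0..1}"
  proof (rule fundamental_theorem_of_calculus)
    fix t :: real assume t: "t \<in> {0..1}"
    \<comment> \<open>The derivative is computed in a complex variable at the real point
      \<open>t\<close> and restricted to the interval afterwards.\<close>
    define x :: complex where "x = of_real t"
    have "(F has_field_derivative deriv F (x ^ 2 * u)) (at (x ^ 2 * u))"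
      using F gauss_domain_open sub[OF t] by (auto intro!: holomorphic_derivI simp: x_def)
    moreover have "((\<lambda>w. w ^ 2 * u) has_field_derivative 2 * x * u) (at x)"
      by (auto intro!: derivative_eq_intros)
    ultimately have DF: "((\<lambda>w. F (w ^ 2 * u)) has_field_derivative deriv F (x ^ 2 * u) * (2 * x * u)) (at x)"
      by (rule DERIV_chain2)
    have Dp: "((\<lambda>w. w ^ (2 * k + 1)) has_field_derivative of_nat (2 * k + 1) * x ^ (2 * k)) (at x)"
      using DERIV_power[OF DERIV_ident, of "2 * k + 1" x UNIV] by simp
    from DERIV_mult[OF Dp DF] have "((\<lambda>w. w ^ (2 * k + 1) * F (w ^ 2 * u)) has_field_derivative
        of_nat (2 * k + 1) * ?f t + 2 * u * ?g t) (at (of_real t))"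
      unfolding x_def by (rule DERIV_cong) (simp add: mult_ac power_add power2_eq_square)
    from has_vector_derivative_real_field[OF this, of "{0..1}"]
    show "((\<lambda>t. of_real t ^ (2 * k + 1) * F (of_real t ^ 2 * u)) has_vector_derivative
        of_nat (2 * k + 1) * ?f t + 2 * u * ?g t) (at t within {0..1})"
      by simp
  qed simp
  have "((\<lambda>t. of_nat (2 * k + 1) * ?f t + 2 * u * ?g t) has_integral
      of_nat (2 * k + 1) * integral {0..1} ?f + 2 * u * integral {0..1} ?g) {0..1}"
    using int by (intro has_integral_add has_integral_mult_right integrable_integral)
  from has_integral_unique[OF this FT]
  have "of_nat (2 * k + 1) * integral {0..1} ?f + 2 * u * integral {0..1} ?g = F u"
    by simp
  hence "of_nat (2 * k + 1) * (of_nat (2 * k + 1) * integral {0..1} ?f + 2 * u * integral {0..1} ?g)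
      = of_nat (2 * k + 1) * F u" by simp
  moreover have "deriv (euler_integral k F) u = of_nat (2 * k + 1) * integral {0..1} ?g"
    using has_field_derivative_euler_integral[OF F u] by (rule DERIV_imp_deriv)
  ultimately show ?thesis
    unfolding euler_integral_def by (simp add: algebra_simps)
qed

lemma half_plus_nat_notin_nonpos_Ints: "1 / 2 + of_nat k \<notin> (\<int>\<^sub>\<le>\<^sub>0 :: complex set)"
proof
  assume "1 / 2 + of_nat k \<in> (\<int>\<^sub>\<le>\<^sub>0 :: complex set)"
  then obtain n where "1 / 2 + of_nat k = - (of_nat n :: complex)" by (elim nonpos_Ints_cases')
  hence "1 / 2 + real k = - real n" by (simp add: complex_eq_iff)
  thus False by linarith
qed

text \<open>Comparing coefficients in \<open>euler_integral_ode\<close> gives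
  \<open>(c + n) g_n = c h_n\<close>, the relation of \<open>fps_hypergeo2_shift\<close>. In
  contrast to \<open>gauss_continuation_raise\<close>, \<open>(c - a) (c - b)\<close> is not
  inverted, so \<open>a\<close> and \<open>b\<close> are arbitrary.\<close>

lemma gauss_continuation_euler_integral:
  assumes F: "gauss_continuation a b (1 / 2 + of_nat k) F"
  shows "gauss_continuation a b (1 / 2 + of_nat k + 1) (euler_integral k F)"
  unfolding gauss_continuation_def
proof
  let ?G = "euler_integral k F" and ?c = "1 / 2 + of_nat k :: complex"
  let ?h = "fps_hypergeo [a, b] [?c] 1"
  have holF: "F holomorphic_on gauss_domain" and exF: "F has_fps_expansion ?h"
    using F by (auto simp: gauss_continuation_def)
  show hol: "?G holomorphic_on gauss_domain"
    by (rule holomorphic_on_euler_integral) fact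
  define g where "g = fps_expansion ?G 0"
  have exG: "?G has_fps_expansion g" unfolding g_def
    using gauss_domain_open zero_in_gauss_domain hol by (rule has_fps_expansion_fps_expansion)
  have eq: "fps_const (of_nat (2 * k + 1)) * g + fps_const 2 * (fps_X * fps_deriv g)
      = fps_const (of_nat (2 * k + 1)) * ?h"
  proof (rule fps_expansion_unique_complex)
    show "(\<lambda>u. of_nat (2 * k + 1) * ?G u + 2 * (u * deriv ?G u)) has_fps_expansion
        fps_const (of_nat (2 * k + 1)) * g + fps_const 2 * (fps_X * fps_deriv g)"
      using exG by (intro fps_expansion_intros)
    have "eventually (\<lambda>u. of_nat (2 * k + 1) * ?G u + 2 * (u * deriv ?G u) =
        of_nat (2 * k + 1) * F u) (nhds 0)"
      by (rule eventually_nhds_in_open[OF gauss_domain_open zero_in_gauss_domain, THEN eventually_mono])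
         (use euler_integral_ode[OF holF, of _ k] in \<open>auto simp: mult_ac\<close>)
    moreover have "(\<lambda>u. of_nat (2 * k + 1) * F u) has_fps_expansion fps_const (of_nat (2 * k + 1)) * ?h"
      using exF by (intro fps_expansion_intros)
    ultimately show "(\<lambda>u. of_nat (2 * k + 1) * ?G u + 2 * (u * deriv ?G u)) has_fps_expansion
        fps_const (of_nat (2 * k + 1)) * ?h"
      by (simp only: has_fps_expansion_cong[OF _ refl])
  qed
  have "g = fps_hypergeo [a, b] [?c + 1] 1"
  proof (rule fps_ext)
    fix n
    have cn: "?c + of_nat n \<noteq> 0"
      using half_plus_nat_notin_nonpos_Ints[of "k + n"] by (auto simp: add_ac)
    have "(2 * of_nat k + 1 + 2 * of_nat n) * g $ n = (2 * of_nat k + 1) * ?h $ n"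
      using arg_cong[OF eq, of "\<lambda>f. f $ n"] by (cases n) (simp_all add: algebra_simps del: fps_hypergeo_nth)
    hence "(?c + of_nat n) * g $ n = ?c * ?h $ n"
      by (simp add: field_simps del: fps_hypergeo_nth)
    thus "g $ n = fps_hypergeo [a, b] [?c + 1] 1 $ n"
      using fps_hypergeo2_shift[OF half_plus_nat_notin_nonpos_Ints, of k n a b] cn
      by (metis mult_left_cancel)
  qed
  thus "?G has_fps_expansion fps_hypergeo [a, b] [?c + 1] 1" using exG by simp
qed

lemma continuous_on_euler_integral:
  assumes "continuous_on (UNIV \<times> gauss_domain) (\<lambda>(\<alpha>::complex, u). F \<alpha> u)"
  shows "continuous_on (UNIV \<times> gauss_domain) (\<lambda>(\<alpha>, u). euler_integral k (F \<alpha>) u)"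
proof -
  have "continuous_on (UNIV \<times> gauss_domain)
    (\<lambda>p. integral (cbox 0 1) (\<lambda>t::real. of_real t ^ (2 * k) * F (fst p) (of_real t ^ 2 * snd p)))"
    by (rule integral_continuous_on_param, unfold case_prod_unfold,
        intro continuous_intros continuous_on_compose2[OF assms[unfolded case_prod_unfold],
          of _ "\<lambda>q. (fst (fst q), of_real (snd q) ^ 2 * snd (fst q))", simplified])
       (auto intro!: gauss_domain_scale_power2)
  thus ?thesis
    unfolding euler_integral_def case_prod_unfold by (auto intro!: continuous_intros)
qed

subsection \<open>The case \<open>c = 1/2\<close>\<close>

text \<open>The entire function \<open>cosh(\<surd>v)\<close>.\<close>

definition cosh_sqrt :: "complex \<Rightarrow> complex" where
  "cosh_sqrt = eval_fps (Abs_fps (\<lambda>n. 1 / fact (2 * n)))"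

lemma cosh_series_even: "(\<lambda>n. 1 / fact (2 * n) * (x\<^sup>2) ^ n) sums cosh (x::complex)"
proof -
  have "(\<lambda>n. if even (2 * n) then x ^ (2 * n) /\<^sub>R fact (2 * n) else 0) sums cosh x"
    using cosh_converges[of x] by (subst sums_mono_reindex) (auto simp: strict_mono_def elim!: evenE)
  thus ?thesis
    by (simp add: scaleR_conv_of_real power_mult inverse_eq_divide)
qed

lemma cosh_sqrt_power2: "cosh_sqrt (x\<^sup>2) = cosh x"
  using cosh_series_even[of x] by (simp add: cosh_sqrt_def eval_fps_def sums_iff)

lemma holomorphic_on_cosh_sqrt [holomorphic_intros]:
  assumes "f holomorphic_on A"
  shows "(\<lambda>z. cosh_sqrt (f z)) holomorphic_on A"
proof -
  \<comment> \<open>At \<open>z\<close> this is the series of cosh at \<open>csqrt z\<close>, hence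
    it converges everywhere.\<close>
  have "summable (\<lambda>n. 1 / fact (2 * n) * z ^ n)" for z :: complex
    using cosh_series_even[of "csqrt z"] by (simp add: sums_iff)
  hence "fps_conv_radius (Abs_fps (\<lambda>n. 1 / fact (2 * n)) :: complex fps) = \<infinity>"
    unfolding fps_conv_radius_def by (intro conv_radius_inftyI'') simp
  hence "cosh_sqrt holomorphic_on UNIV"
    unfolding cosh_sqrt_def by (intro holomorphic_on_eval_fps) auto
  from holomorphic_on_compose_gen[OF assms this] show ?thesis by (simp add: o_def)
qed

lemma cosh_sqrt_has_field_derivative:
  "(cosh_sqrt has_field_derivative deriv cosh_sqrt v) (at v)"
  "(deriv cosh_sqrt has_field_derivative deriv (deriv cosh_sqrt) v) (at v)"
proof -
  have "cosh_sqrt holomorphic_on UNIV"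
    using holomorphic_on_cosh_sqrt[of "\<lambda>x. x" UNIV] by (simp add: holomorphic_on_ident)
  thus "(cosh_sqrt has_field_derivative deriv cosh_sqrt v) (at v)"
    "(deriv cosh_sqrt has_field_derivative deriv (deriv cosh_sqrt) v) (at v)"
    by (auto intro!: holomorphic_derivI[of _ UNIV] holomorphic_deriv)
qed

text \<open>Differentiate \<open>cosh_sqrt (x^2) = cosh x\<close> twice. Every \<open>v\<close> is a
  square, and no division by \<open>x\<close> takes place, so \<open>v = 0\<close> is
  included.\<close>

lemma cosh_sqrt_ode:
  "4 * v * deriv (deriv cosh_sqrt) v + 2 * deriv cosh_sqrt v = cosh_sqrt v"
proof -
  have 1: "deriv cosh_sqrt (x\<^sup>2) * (2 * x) = sinh x" for x :: complex
  proof (rule DERIV_unique)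
    show "((\<lambda>x. cosh_sqrt (x\<^sup>2)) has_field_derivative deriv cosh_sqrt (x\<^sup>2) * (2 * x)) (at x)"
      by (rule DERIV_chain2[OF cosh_sqrt_has_field_derivative(1)]) (auto intro!: derivative_eq_intros)
    show "((\<lambda>x. cosh_sqrt (x\<^sup>2)) has_field_derivative sinh x) (at x)"
      unfolding cosh_sqrt_power2 by (auto intro!: derivative_eq_intros)
  qed
  define x where "x = csqrt v"
  have "((\<lambda>x. deriv cosh_sqrt (x\<^sup>2) * (2 * x)) has_field_derivative
      deriv (deriv cosh_sqrt) (x\<^sup>2) * (2 * x) * (2 * x) + 2 * deriv cosh_sqrt (x\<^sup>2)) (at x)"
    by (rule DERIV_mult DERIV_chain2[OF cosh_sqrt_has_field_derivative(2)] derivative_eq_intros refl | simp)+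
  moreover have "((\<lambda>x. deriv cosh_sqrt (x\<^sup>2) * (2 * x)) has_field_derivative cosh x) (at x)"
    unfolding 1 by (auto intro!: derivative_eq_intros)
  ultimately have eq: "deriv (deriv cosh_sqrt) (x\<^sup>2) * (2 * x) * (2 * x) + 2 * deriv cosh_sqrt (x\<^sup>2)
      = cosh_sqrt (x\<^sup>2)"
    unfolding cosh_sqrt_power2 by (rule DERIV_unique)
  have xv: "v = x\<^sup>2" by (simp add: x_def)
  show ?thesis
    unfolding xv using eq by (simp add: power2_eq_square mult_ac)
qed

text \<open>
  The continuation of \<open>arsinh(\<surd>(-u)) / \<surd>(-u)\<close> to the cut plane: no root of \<open>-u\<close> is taken,
  so there is no branch point at \<open>0\<close>.
\<close>

definition arsinh_quot :: "complex \<Rightarrow> complex" where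
  "arsinh_quot = euler_integral 0 (\<lambda>u. 1 / csqrt (1 - u))"

lemma gauss_domain_iff: "u \<in> gauss_domain \<longleftrightarrow> 1 - u \<notin> \<real>\<^sub>\<le>\<^sub>0"
  by (force simp: gauss_domain_def complex_nonpos_Reals_iff complex_eq_iff image_iff)

lemma csqrt_one_minus_nonzero: "u \<in> gauss_domain \<Longrightarrow> csqrt (1 - u) \<noteq> 0"
  by (auto simp: gauss_domain_iff)

lemma csqrt_one_minus_has_field_derivative:
  assumes "u \<in> gauss_domain"
  shows "((\<lambda>u. csqrt (1 - u)) has_field_derivative - 1 / (2 * csqrt (1 - u))) (at u)"
  by (rule DERIV_chain2[OF has_field_derivative_csqrt, of _ _ "-1", THEN DERIV_cong])
     (use assms in \<open>auto simp: gauss_domain_iff inverse_eq_divide intro!: derivative_eq_intros\<close>)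

lemma holomorphic_on_csqrt_one_minus: "(\<lambda>u. csqrt (1 - u)) holomorphic_on gauss_domain"
  using csqrt_one_minus_has_field_derivative gauss_domain_open by (auto simp: holomorphic_on_open)

lemma holomorphic_on_arsinh_quot: "arsinh_quot holomorphic_on gauss_domain"
  unfolding arsinh_quot_def
  by (intro holomorphic_on_euler_integral holomorphic_intros holomorphic_on_csqrt_one_minus)
     (auto simp: gauss_domain_iff)

lemma arsinh_quot_has_field_derivative:
  "u \<in> gauss_domain \<Longrightarrow> (arsinh_quot has_field_derivative deriv arsinh_quot u) (at u)"
  using holomorphic_on_arsinh_quot gauss_domain_open by (rule holomorphic_derivI)

text \<open>With \<open>u = - s^2\<close> this says that \<open>s\<close> times
  \<open>arsinh_quot (- s^2)\<close> has the derivative of arsinh; it is the case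
  \<open>k = 0\<close> of \<open>euler_integral_ode\<close>.\<close>

lemma arsinh_quot_ode:
  assumes "u \<in> gauss_domain"
  shows "arsinh_quot u + 2 * u * deriv arsinh_quot u = 1 / csqrt (1 - u)"
proof -
  have "(\<lambda>u. 1 / csqrt (1 - u)) holomorphic_on gauss_domain"
    by (intro holomorphic_intros holomorphic_on_csqrt_one_minus) (auto simp: gauss_domain_iff)
  from euler_integral_ode[OF this assms, of 0] show ?thesis by (simp add: arsinh_quot_def)
qed

text \<open>At \<open>u = - sinh^2(\<xi>/2)\<close> the argument of \<open>cosh_sqrt\<close> is the
  square of \<open>\<alpha> \<xi>\<close>. As cosh is even, only the square of \<xi> is needed, and
  that is \<open>- 4 u\<close> times the square of \<open>arsinh_quot u\<close>, which is
  holomorphic across 0.\<close>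

definition gauss_half :: "complex \<Rightarrow> complex \<Rightarrow> complex" where
  "gauss_half \<alpha> u = cosh_sqrt (- 4 * \<alpha>\<^sup>2 * u * (arsinh_quot u)\<^sup>2) / csqrt (1 - u)"

lemma holomorphic_on_gauss_half: "gauss_half \<alpha> holomorphic_on gauss_domain"
  unfolding gauss_half_def
  by (intro holomorphic_intros holomorphic_on_csqrt_one_minus holomorphic_on_arsinh_quot)
     (auto simp: gauss_domain_iff)

text \<open>This is the hypergeometric equation in factored form: up to constants, \<open>D\<close>
  is the raising operator at \<open>c = 1/2\<close>, and the operator applied to \<open>D\<close>
  lowers back from \<open>3/2\<close>. The eigenvalue is
  \<open>(c - a) (c - b) = - \<alpha>^2\<close>.\<close>

lemma gauss_half_ode:
  fixes \<alpha> :: complex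
  defines "D \<equiv> (\<lambda>u. (1 - u) * deriv (gauss_half \<alpha>) u - 1 / 2 * gauss_half \<alpha> u)"
  assumes u: "u \<in> gauss_domain"
  shows "u * deriv D u + 1 / 2 * D u = - \<alpha>\<^sup>2 * gauss_half \<alpha> u"
proof -
  define v where "v = (\<lambda>u. - 4 * \<alpha>\<^sup>2 * u * (arsinh_quot u)\<^sup>2)"
  \<comment> \<open>By \<open>arsinh_quot_ode\<close> the derivative of \<open>arsinh_quot\<close>
    drops out here.\<close>
  have dv: "(v has_field_derivative - 4 * \<alpha>\<^sup>2 * arsinh_quot u / csqrt (1 - u)) (at u)"
    if "u \<in> gauss_domain" for u
  proof -
    have "(v has_field_derivative
        - 4 * \<alpha>\<^sup>2 * arsinh_quot u * (arsinh_quot u + 2 * u * deriv arsinh_quot u)) (at u)"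
      unfolding v_def
      by (auto intro!: derivative_eq_intros arsinh_quot_has_field_derivative that
          simp: algebra_simps power2_eq_square)
    thus ?thesis by (simp add: arsinh_quot_ode[OF that])
  qed
  \<comment> \<open>The two terms containing \<open>cosh_sqrt (v u)\<close> itself cancel, so only
    its first derivative remains.\<close>
  have D_eq: "D u = - 4 * \<alpha>\<^sup>2 * arsinh_quot u * deriv cosh_sqrt (v u)" if "u \<in> gauss_domain" for u
  proof -
    define S where "S = csqrt (1 - u)"
    have S: "S \<noteq> 0" "1 - u = S\<^sup>2" using csqrt_one_minus_nonzero[OF that] by (auto simp: S_def)
    have "((\<lambda>u. cosh_sqrt (v u)) has_field_derivative
        deriv cosh_sqrt (v u) * (- 4 * \<alpha>\<^sup>2 * arsinh_quot u / S)) (at u)"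
      using DERIV_chain2[OF cosh_sqrt_has_field_derivative(1) dv[OF that]] by (simp add: S_def)
    from DERIV_divide[OF this csqrt_one_minus_has_field_derivative[OF that]]
    have "(gauss_half \<alpha> has_field_derivative
        (deriv cosh_sqrt (v u) * (- 4 * \<alpha>\<^sup>2 * arsinh_quot u / S) * S - cosh_sqrt (v u) * (- 1 / (2 * S)))
           / (S * S)) (at u)"
      using S unfolding gauss_half_def[abs_def] v_def S_def by simp
    hence dF: "deriv (gauss_half \<alpha>) u =
        (deriv cosh_sqrt (v u) * (- 4 * \<alpha>\<^sup>2 * arsinh_quot u / S) * S - cosh_sqrt (v u) * (- 1 / (2 * S)))
           / (S * S)" by (rule DERIV_imp_deriv)
    have F: "gauss_half \<alpha> u = cosh_sqrt (v u) / S"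
      by (simp add: gauss_half_def v_def S_def)
    show ?thesis
      unfolding D_def S(2) dF F using S(1) by (simp add: field_simps power2_eq_square)
  qed
  define S where "S = csqrt (1 - u)"
  have S: "S \<noteq> 0" using csqrt_one_minus_nonzero[OF u] by (auto simp: S_def)
  define L L' E E' E'' where "L = arsinh_quot u" "L' = deriv arsinh_quot u" "E = cosh_sqrt (v u)"
    "E' = deriv cosh_sqrt (v u)" "E'' = deriv (deriv cosh_sqrt) (v u)"
  note defs = this S_def
  have "((\<lambda>u. deriv cosh_sqrt (v u)) has_field_derivative E'' * (- 4 * \<alpha>\<^sup>2 * L / S)) (at u)"
    using DERIV_chain2[OF cosh_sqrt_has_field_derivative(2) dv[OF u]] by (simp add: defs)
  from DERIV_cmult[OF DERIV_mult[OF arsinh_quot_has_field_derivative[OF u] this], of "- 4 * \<alpha>\<^sup>2"]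
  have "((\<lambda>u. - 4 * \<alpha>\<^sup>2 * arsinh_quot u * deriv cosh_sqrt (v u)) has_field_derivative
      - 4 * \<alpha>\<^sup>2 * (L' * E' + E'' * (- 4 * \<alpha>\<^sup>2 * L / S) * L)) (at u)"
    by (simp add: defs mult_ac)
  hence "(D has_field_derivative - 4 * \<alpha>\<^sup>2 * (L' * E' + E'' * (- 4 * \<alpha>\<^sup>2 * L / S) * L)) (at u)"
    using gauss_domain_open u by (rule has_field_derivative_transform_within_open) (simp add: D_eq)
  hence D': "deriv D u = - 4 * \<alpha>\<^sup>2 * (L' * E' + E'' * (- 4 * \<alpha>\<^sup>2 * L / S) * L)"
    by (rule DERIV_imp_deriv)
  have "4 * v u * E'' + 2 * E' = E" using cosh_sqrt_ode[of "v u"] by (simp add: defs)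
  hence ode: "4 * (- 4 * \<alpha>\<^sup>2 * u * L\<^sup>2) * E'' + 2 * E' = E" by (simp add: v_def defs)
  have L': "(L + 2 * u * L') * S = 1" using arsinh_quot_ode[OF u] S by (simp add: defs)
  have gh: "gauss_half \<alpha> u = E / S" by (simp add: gauss_half_def v_def defs)
  have "u * deriv D u + 1 / 2 * D u =
      - 4 * \<alpha>\<^sup>2 * (u * L' * E' + u * E'' * (- 4 * \<alpha>\<^sup>2 * L / S) * L) - 2 * \<alpha>\<^sup>2 * L * E'"
    unfolding D' D_eq[OF u] by (simp add: defs algebra_simps)
  also have "\<dots> = - 2 * \<alpha>\<^sup>2 * E' * ((L + 2 * u * L') * S) / S - 4 * \<alpha>\<^sup>2 * (u * E'' * (- 4 * \<alpha>\<^sup>2 * L / S) * L)"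
    using S by (simp add: field_simps)
  also have "\<dots> = - \<alpha>\<^sup>2 * (4 * (- 4 * \<alpha>\<^sup>2 * u * L\<^sup>2) * E'' + 2 * E') / S"
    unfolding L' using S by (simp add: field_simps power2_eq_square)
  also have "\<dots> = - \<alpha>\<^sup>2 * gauss_half \<alpha> u"
    unfolding ode gh by simp
  finally show ?thesis .
qed

text \<open>The factored equation, read on Taylor coefficients, is the hypergeometric
  recurrence.\<close>

lemma gauss_continuation_gauss_half:
  "gauss_continuation (1 / 2 - \<alpha>) (1 / 2 + \<alpha>) (1 / 2) (gauss_half \<alpha>)"
proof -
  let ?F = "gauss_half \<alpha>"
  define f where "f = fps_expansion ?F 0"
  have exF: "?F has_fps_expansion f" unfolding f_def
    using gauss_domain_open zero_in_gauss_domain holomorphic_on_gauss_half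
    by (rule has_fps_expansion_fps_expansion)
  define D where "D = (\<lambda>u. (1 - u) * deriv ?F u - 1 / 2 * ?F u)"
  define d where "d = (1 - fps_X) * fps_deriv f - fps_const (1 / 2) * f"
  have exD: "D has_fps_expansion d"
    unfolding D_def d_def using exF by (intro fps_expansion_intros)
  have eq: "fps_X * fps_deriv d + fps_const (1 / 2) * d = fps_const (- \<alpha>\<^sup>2) * f"
  proof (rule fps_expansion_unique_complex)
    show "(\<lambda>u. u * deriv D u + 1 / 2 * D u) has_fps_expansion
        fps_X * fps_deriv d + fps_const (1 / 2) * d"
      using exD by (intro fps_expansion_intros)
    have "eventually (\<lambda>u. u * deriv D u + 1 / 2 * D u = - \<alpha>\<^sup>2 * ?F u) (nhds 0)"
      by (rule eventually_nhds_in_open[OF gauss_domain_open zero_in_gauss_domain, THEN eventually_mono])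
         (use gauss_half_ode[of _ \<alpha>] in \<open>simp add: D_def\<close>)
    moreover have "(\<lambda>u. - \<alpha>\<^sup>2 * ?F u) has_fps_expansion fps_const (- \<alpha>\<^sup>2) * f"
      using exF by (intro fps_expansion_intros)
    ultimately show "(\<lambda>u. u * deriv D u + 1 / 2 * D u) has_fps_expansion fps_const (- \<alpha>\<^sup>2) * f"
      by (simp only: has_fps_expansion_cong[OF _ refl])
  qed
  have "f = fps_hypergeo [1 / 2 - \<alpha>, 1 / 2 + \<alpha>] [1 / 2] 1"
  proof (rule fps_hypergeo2_unique)
    show "1 / 2 \<notin> (\<int>\<^sub>\<le>\<^sub>0 :: complex set)"
      using half_plus_nat_notin_nonpos_Ints[of 0] by simp
    have "f $ 0 = ?F 0" using has_fps_expansion_imp_0_eq_fps_nth_0[OF exF] by simp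
    thus "f $ 0 = 1" using cosh_sqrt_power2[of 0] by (simp add: gauss_half_def)
    fix n
    define x where "x = f $ n"
    define y where "y = of_nat (Suc n) * f $ Suc n"
    have dn: "d $ n = y - of_nat n * x - x / 2"
      by (cases n) (simp_all add: d_def x_def y_def ring_distribs del: of_nat_Suc)
    have dn': "of_nat n * d $ n + 1 / 2 * d $ n = - \<alpha>\<^sup>2 * x"
      using arg_cong[OF eq, of "\<lambda>f. f $ n"] by (cases n) (simp_all add: x_def)
    \<comment> \<open>Combined with \<open>- \<alpha>^2 x\<close>, the square
      \<open>(1/2 + n)^2 x\<close> factors into the two numerator parameters of the
      recurrence.\<close>
    have "(1 / 2 + of_nat n) * y =
        (of_nat n * d $ n + 1 / 2 * d $ n) + (1 / 2 + of_nat n)\<^sup>2 * x"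
      unfolding dn by (simp add: field_simps power2_eq_square)
    hence "(1 / 2 + of_nat n) * y = (1 / 2 - \<alpha> + of_nat n) * (1 / 2 + \<alpha> + of_nat n) * x"
      unfolding dn' by (simp add: algebra_simps power2_eq_square)
    thus "of_nat (Suc n) * (1 / 2 + of_nat n) * f $ Suc n =
        (1 / 2 - \<alpha> + of_nat n) * (1 / 2 + \<alpha> + of_nat n) * f $ n"
      by (simp add: x_def y_def mult_ac del: of_nat_Suc)
  qed
  thus ?thesis
    using exF holomorphic_on_gauss_half by (simp add: gauss_continuation_def)
qed

lemma continuous_on_gauss_half:
  "continuous_on (UNIV \<times> gauss_domain) (\<lambda>(\<alpha>, u). gauss_half \<alpha> u)"
proof -
  have 1: "continuous_on UNIV cosh_sqrt"
    using holomorphic_on_cosh_sqrt[of "\<lambda>x. x" UNIV]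
    by (auto intro!: holomorphic_on_imp_continuous_on simp: holomorphic_on_ident)
  have 2: "continuous_on gauss_domain arsinh_quot"
    by (rule holomorphic_on_imp_continuous_on holomorphic_on_arsinh_quot)+
  have 3: "continuous_on gauss_domain (\<lambda>u. csqrt (1 - u))"
    by (rule holomorphic_on_imp_continuous_on holomorphic_on_csqrt_one_minus)+
  show ?thesis
    unfolding gauss_half_def case_prod_unfold
    by (intro continuous_intros continuous_on_compose2[OF 1] continuous_on_compose2[OF 2]
        continuous_on_compose2[OF 3]) (auto simp: gauss_domain_iff)
qed

section \<open>The substitution \<open>u = - sinh^2(\<xi>/2)\<close> on a strip\<close>

definition open_strip :: "complex set" where
  "open_strip = {\<xi>. \<bar>Im \<xi>\<bar> < pi}"

lemma convex_open_strip: "convex open_strip"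
proof -
  have eq: "open_strip = {\<xi>. Im \<xi> < pi} \<inter> {\<xi>. Im \<xi> > - pi}"
    by (auto simp: open_strip_def)
  show ?thesis
    unfolding eq by (intro convex_Int convex_halfspace_Im_lt convex_halfspace_Im_gt)
qed

lemma cosh_half_Re_pos:
  assumes "\<xi> \<in> open_strip"
  shows "Re (cosh (\<xi> / 2)) > 0"
proof -
  have "cos (Im \<xi> / 2) > 0"
    using assms by (intro cos_gt_zero_pi) (auto simp: open_strip_def)
  moreover have "Re (cosh (\<xi> / 2)) = cosh (Re \<xi> / 2) * cos (Im \<xi> / 2)"
    by (simp add: cosh_field_def Re_exp algebra_simps)
  ultimately show ?thesis by (simp add: cosh_real_pos)
qed

text \<open>Here \<open>1 - u\<close> is the square of \<open>cosh (\<xi> / 2)\<close>, a number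
  with positive real part. Such a square avoids the cut, and its principal root is the number
  itself.\<close>

lemma gauss_domain_sinh_half:
  assumes "\<xi> \<in> open_strip"
  shows "- (sinh (\<xi> / 2))\<^sup>2 \<in> gauss_domain" "csqrt (1 + (sinh (\<xi> / 2))\<^sup>2) = cosh (\<xi> / 2)"
proof -
  let ?s = "sinh (\<xi> / 2)" and ?c = "cosh (\<xi> / 2)"
  have eq: "1 + ?s\<^sup>2 = ?c\<^sup>2"
    by (simp add: cosh_square_eq)
  note pos = cosh_half_Re_pos[OF assms]
  show "csqrt (1 + ?s\<^sup>2) = ?c"
    unfolding eq using pos by (intro csqrt_square) auto
  have "?c\<^sup>2 \<notin> \<real>\<^sub>\<le>\<^sub>0"
  proof
    assume "?c\<^sup>2 \<in> \<real>\<^sub>\<le>\<^sub>0"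
    hence "Re ?c * Re ?c - Im ?c * Im ?c \<le> 0" "Re ?c * Im ?c = 0"
      by (auto simp: complex_nonpos_Reals_iff power2_eq_square)
    with pos have "Re ?c * Re ?c \<le> 0" by auto
    with pos show False by (simp add: mult_le_0_iff)
  qed
  thus "- ?s\<^sup>2 \<in> gauss_domain"
    unfolding gauss_domain_iff by (simp add: eq)
qed

text \<open>The difference of the two sides has derivative 0 on the convex strip, by
  \<open>arsinh_quot_ode\<close>, and vanishes at 0. No inverse function or branch is
  involved.\<close>

lemma sinh_times_arsinh_quot:
  assumes "\<xi> \<in> open_strip"
  shows "sinh (\<xi> / 2) * arsinh_quot (- (sinh (\<xi> / 2))\<^sup>2) = \<xi> / 2"
proof -
  let ?f = "\<lambda>\<xi>. sinh (\<xi> / 2) * arsinh_quot (- (sinh (\<xi> / 2))\<^sup>2) - \<xi> / 2"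
  have "\<exists>c. \<forall>\<xi>\<in>open_strip. ?f \<xi> = c"
  proof (rule has_field_derivative_zero_constant)
    fix \<xi> assume \<xi>: "\<xi> \<in> open_strip"
    define s c where "s = sinh (\<xi> / 2)" and "c = cosh (\<xi> / 2)"
    have c: "c \<noteq> 0" using cosh_half_Re_pos[OF \<xi>] by (auto simp: c_def)
    note gd = gauss_domain_sinh_half[OF \<xi>, folded s_def c_def]
    have "((\<lambda>\<xi>. - (sinh (\<xi> / 2))\<^sup>2) has_field_derivative - s * c) (at \<xi>)"
      unfolding s_def c_def by (auto intro!: derivative_eq_intros)
    with arsinh_quot_has_field_derivative[OF gd(1)]
    have "((\<lambda>\<xi>. arsinh_quot (- (sinh (\<xi> / 2))\<^sup>2)) has_field_derivative
        deriv arsinh_quot (- s\<^sup>2) * (- s * c)) (at \<xi>)"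
      unfolding s_def c_def by (rule DERIV_chain2)
    moreover have "((\<lambda>\<xi>. sinh (\<xi> / 2)) has_field_derivative c / 2) (at \<xi>)"
      unfolding c_def by (auto intro!: derivative_eq_intros)
    ultimately have "(?f has_field_derivative c / 2 * arsinh_quot (- s\<^sup>2)
        + s * (deriv arsinh_quot (- s\<^sup>2) * (- s * c)) - 1 / 2) (at \<xi>)"
      by (auto intro!: derivative_eq_intros simp: s_def c_def)
    moreover have "c / 2 * arsinh_quot (- s\<^sup>2) + s * (deriv arsinh_quot (- s\<^sup>2) * (- s * c)) - 1 / 2
        = c / 2 * (arsinh_quot (- s\<^sup>2) + 2 * (- s\<^sup>2) * deriv arsinh_quot (- s\<^sup>2)) - 1 / 2"
      by (simp add: algebra_simps power2_eq_square)
    moreover have "\<dots> = 0"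
      using c by (simp only: arsinh_quot_ode[OF gd(1)]) (simp add: gd(2))
    ultimately have "(?f has_field_derivative 0) (at \<xi>)"
      by (simp only:)
    thus "(?f has_field_derivative 0) (at \<xi> within open_strip)"
      by (rule has_field_derivative_at_within)
  qed (rule convex_open_strip)
  moreover have "0 \<in> open_strip" by (auto simp: open_strip_def)
  ultimately have "?f \<xi> = ?f 0" using assms by metis
  thus ?thesis by simp
qed

lemma gauss_half_cosh:
  assumes "\<xi> \<in> open_strip"
  shows "gauss_half \<alpha> (- (sinh (\<xi> / 2))\<^sup>2) = cosh (\<alpha> * \<xi>) / cosh (\<xi> / 2)"
proof -
  let ?s = "sinh (\<xi> / 2)"
  have "- 4 * \<alpha>\<^sup>2 * (- ?s\<^sup>2) * (arsinh_quot (- ?s\<^sup>2))\<^sup>2 = (2 * \<alpha> * (?s * arsinh_quot (- ?s\<^sup>2)))\<^sup>2"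
    by (simp add: power_mult_distrib)
  also have "\<dots> = (\<alpha> * \<xi>)\<^sup>2"
    unfolding sinh_times_arsinh_quot[OF assms] by simp
  finally show ?thesis
    using gauss_domain_sinh_half[OF assms] by (simp add: gauss_half_def cosh_sqrt_power2 del: mult_minus_left mult_minus_right)
qed

subsection \<open>The Jacobi polynomials with parameters \<open>\<alpha>\<close> and \<open>-\<alpha>\<close>\<close>

text \<open>The sign \<open>s\<close> covers both factors of Rodrigues' formula. The falling
  factorial is written with \<open>gchoose\<close> so that Leibniz' rule turns into a sum of
  binomial products.\<close>

lemma higher_deriv_one_plus_powr:
  fixes s c z :: complex
  assumes "1 + s * z \<notin> \<real>\<^sub>\<le>\<^sub>0"
  shows "(deriv ^^ j) (\<lambda>w. (1 + s * w) powr c) z =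
           s ^ j * (fact j * (c gchoose j)) * (1 + s * z) powr (c - of_nat j)"
  using assms
proof (induction j arbitrary: z)
  case 0 thus ?case by simp
next
  case (Suc j)
  let ?A = "(\<lambda>w. 1 + s * w) -` (- \<real>\<^sub>\<le>\<^sub>0)"
  have "open ?A"
    by (intro open_vimage open_Compl closed_nonpos_Reals_complex continuous_intros)
  hence "eventually (\<lambda>w. w \<in> ?A) (nhds z)"
    using Suc.prems by (intro eventually_nhds_in_open) auto
  hence "eventually (\<lambda>w. (deriv ^^ j) (\<lambda>w. (1 + s * w) powr c) w =
      s ^ j * (fact j * (c gchoose j)) * (1 + s * w) powr (c - of_nat j)) (nhds z)"
    by eventually_elim (auto intro!: Suc.IH)
  hence "deriv ((deriv ^^ j) (\<lambda>w. (1 + s * w) powr c)) z =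
      deriv (\<lambda>w. s ^ j * (fact j * (c gchoose j)) * (1 + s * w) powr (c - of_nat j)) z"
    by (rule deriv_cong_ev) simp
  also have "\<dots> = s ^ j * (fact j * (c gchoose j)) *
      ((c - of_nat j) * (1 + s * z) powr (c - of_nat j - 1) * s)"
  proof (rule DERIV_imp_deriv, rule DERIV_cmult)
    show "((\<lambda>w. (1 + s * w) powr (c - of_nat j)) has_field_derivative
        (c - of_nat j) * (1 + s * z) powr (c - of_nat j - 1) * s) (at z)"
      using Suc.prems
      by (intro DERIV_chain2[OF has_field_derivative_powr]) (auto intro!: derivative_eq_intros)
  qed
  also have "\<dots> = s ^ Suc j * (fact (Suc j) * (c gchoose Suc j)) *
      (1 + s * z) powr (c - of_nat (Suc j))"
    by (simp only: gbinomial_mult_fact prod.atLeast0_lessThan_Suc) (simp add: algebra_simps)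
  finally show ?case by simp
qed

definition jacobi_coeff :: "nat \<Rightarrow> complex \<Rightarrow> complex \<Rightarrow> nat \<Rightarrow> complex" where
  "jacobi_coeff n \<alpha> \<beta> j = ((\<alpha> + of_nat n) gchoose j) * ((\<beta> + of_nat n) gchoose (n - j))"

text \<open>Leibniz' rule in Rodrigues' formula; the powers with exponents \<alpha> and \<beta>
  cancel against the prefactor. The explicit sum permits evaluation on the cuts, where the values of
  coth at positive reals lie.\<close>

lemma poly_jacobi_poly:
  "poly (jacobi_poly n \<alpha> \<beta>) x =
     (\<Sum>j\<le>n. jacobi_coeff n \<alpha> \<beta> j * ((x - 1) / 2) ^ (n - j) * ((x + 1) / 2) ^ j)"
proof -
  define p where "p = (\<Sum>j\<le>n. smult (jacobi_coeff n \<alpha> \<beta> j) ([:- 1 / 2, 1 / 2:] ^ (n - j) * [:1 / 2, 1 / 2:] ^ j))"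
  have poly_p: "poly p x = (\<Sum>j\<le>n. jacobi_coeff n \<alpha> \<beta> j * ((x - 1) / 2) ^ (n - j) * ((x + 1) / 2) ^ j)" for x
    by (simp add: p_def poly_sum algebra_simps diff_divide_distrib add_divide_distrib)
  have "jacobi_poly n \<alpha> \<beta> = p"
  proof (rule jacobi_poly_eqI)
    fix z assume "z \<in> jacobi_domain"
    hence z: "1 - z \<notin> \<real>\<^sub>\<le>\<^sub>0" "1 + z \<notin> \<real>\<^sub>\<le>\<^sub>0"
      by (force simp: jacobi_domain_def complex_nonpos_Reals_iff complex_eq_iff image_iff)+
    hence nz: "1 - z \<noteq> 0" "1 + z \<noteq> 0" by auto
    let ?f = "\<lambda>w. (1 - w) powr (\<alpha> + of_nat n)" and ?g = "\<lambda>w. (1 + w) powr (\<beta> + of_nat n)"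
    have "(deriv ^^ n) (\<lambda>w. ?f w * ?g w) z =
        (\<Sum>i = 0..n. of_nat (n choose i) * (deriv ^^ i) ?f z * (deriv ^^ (n - i)) ?g z)"
      using z by (intro higher_deriv_mult_at analytic_intros) auto
    also have "\<dots> = (\<Sum>i\<le>n. (1 - z) powr \<alpha> * (1 + z) powr \<beta> *
        (fact n * jacobi_coeff n \<alpha> \<beta> i * (- 1) ^ i * (1 - z) ^ (n - i) * (1 + z) ^ i))"
      unfolding atMost_atLeast0
    proof (rule sum.cong[OF refl])
      fix i assume i: "i \<in> {0..n}"
      have f: "(deriv ^^ i) ?f z = (- 1) ^ i * (fact i * ((\<alpha> + of_nat n) gchoose i)) *
          ((1 - z) powr \<alpha> * (1 - z) ^ (n - i))"
      proof -
        have "\<alpha> + of_nat n - of_nat i = \<alpha> + of_nat (n - i)"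
          using i by (simp add: of_nat_diff)
        hence "(1 - z) powr (\<alpha> + of_nat n - of_nat i) = (1 - z) powr \<alpha> * (1 - z) ^ (n - i)"
          using nz by (simp only: powr_add powr_nat' simp_thms)
        thus ?thesis using higher_deriv_one_plus_powr[of "- 1" z i "\<alpha> + of_nat n"] z by simp
      qed
      have g: "(deriv ^^ (n - i)) ?g z = (fact (n - i) * ((\<beta> + of_nat n) gchoose (n - i))) *
          ((1 + z) powr \<beta> * (1 + z) ^ i)"
      proof -
        have "\<beta> + of_nat n - of_nat (n - i) = \<beta> + of_nat i"
          using i by (simp add: of_nat_diff)
        hence "(1 + z) powr (\<beta> + of_nat n - of_nat (n - i)) = (1 + z) powr \<beta> * (1 + z) ^ i"
          using nz by (simp only: powr_add powr_nat' simp_thms)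
        thus ?thesis using higher_deriv_one_plus_powr[of 1 z "n - i" "\<beta> + of_nat n"] z by simp
      qed
      have "of_nat (n choose i) * fact i * fact (n - i) = (fact n :: complex)"
        using i by (simp add: binomial_fact)
      thus "of_nat (n choose i) * (deriv ^^ i) ?f z * (deriv ^^ (n - i)) ?g z =
          (1 - z) powr \<alpha> * (1 + z) powr \<beta> *
          (fact n * jacobi_coeff n \<alpha> \<beta> i * (- 1) ^ i * (1 - z) ^ (n - i) * (1 + z) ^ i)"
        unfolding f g jacobi_coeff_def by (simp flip: \<open>_ = fact n\<close> add: mult_ac)
    qed
    finally have D: "(deriv ^^ n) (\<lambda>w. ?f w * ?g w) z = \<dots>" .
    have "(- 1) ^ n / (2 ^ n * fact n) * (1 - z) powr (- \<alpha>) * (1 + z) powr (- \<beta>) *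
        (deriv ^^ n) (\<lambda>w. ?f w * ?g w) z =
        (\<Sum>i\<le>n. (- 1) ^ n / 2 ^ n * (jacobi_coeff n \<alpha> \<beta> i * (- 1) ^ i * (1 - z) ^ (n - i) * (1 + z) ^ i))"
      unfolding D sum_distrib_left
      using nz by (intro sum.cong refl) (simp add: powr_minus field_simps)
    also have "\<dots> = poly p z"
      unfolding poly_p
    proof (rule sum.cong[OF refl])
      fix i assume i: "i \<in> {..n}"
      have "(z - 1) ^ (n - i) = (- 1) ^ (n - i) * (1 - z) ^ (n - i)"
        by (simp flip: power_mult_distrib)
      moreover have "(- 1) ^ n * (- 1) ^ i = ((- 1) ^ (n - i) :: complex)"
        using i by (simp add: power_add[symmetric] minus_one_power_iff)
      moreover have "(2 :: complex) ^ n = 2 ^ (n - i) * 2 ^ i"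
        using i by (simp flip: power_add)
      ultimately show "(- 1) ^ n / 2 ^ n * (jacobi_coeff n \<alpha> \<beta> i * (- 1) ^ i * (1 - z) ^ (n - i) * (1 + z) ^ i)
          = jacobi_coeff n \<alpha> \<beta> i * ((z - 1) / 2) ^ (n - i) * ((z + 1) / 2) ^ i"
        by (simp add: power_divide add_ac mult_ac)
    qed
    finally show "poly p z = (- 1) ^ n / (2 ^ n * fact n) * (1 - z) powr (- \<alpha>) * (1 + z) powr (- \<beta>) *
        (deriv ^^ n) (\<lambda>w. ?f w * ?g w) z" by simp
  qed
  thus ?thesis by (simp add: poly_p)
qed

section \<open>Exponential sums and the differential recurrence in \<open>m\<close>\<close>

definition exp_jacobi :: "nat \<Rightarrow> complex \<Rightarrow> complex \<Rightarrow> complex" where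
  "exp_jacobi m a \<xi> = exp (- a * \<xi>) * poly (jacobi_poly m a (- a)) (cosh \<xi> / sinh \<xi>)"

definition jacobi_exp_sum :: "nat \<Rightarrow> complex \<Rightarrow> complex \<Rightarrow> complex" where
  "jacobi_exp_sum m a \<xi> =
     (\<Sum>j\<le>m. jacobi_coeff m a (- a) j * exp ((2 * of_nat j - of_nat m - a) * \<xi>))"

text \<open>The two linear factors of the Jacobi sum at coth are \<open>exp (- \<xi>)\<close> and
  \<open>exp \<xi>\<close>, each divided by \<open>2 sinh \<xi>\<close>; the denominators combine to
  a common power.\<close>

lemma exp_jacobi_eq:
  assumes "sinh \<xi> \<noteq> 0"
  shows "exp_jacobi m a \<xi> = jacobi_exp_sum m a \<xi> / (2 * sinh \<xi>) ^ m"
proof -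
  have 1: "(cosh \<xi> / sinh \<xi> - 1) / 2 = exp (- \<xi>) / (2 * sinh \<xi>)"
    "(cosh \<xi> / sinh \<xi> + 1) / 2 = exp \<xi> / (2 * sinh \<xi>)"
    using assms by (simp_all add: divide_simps) (simp_all add: sinh_field_def cosh_field_def field_simps)
  have "exp (- a * \<xi>) * (jacobi_coeff m a (- a) j * (exp (- \<xi>) / (2 * sinh \<xi>)) ^ (m - j) *
      (exp \<xi> / (2 * sinh \<xi>)) ^ j) =
      jacobi_coeff m a (- a) j * exp ((2 * of_nat j - of_nat m - a) * \<xi>) / (2 * sinh \<xi>) ^ m"
    if "j \<le> m" for j
  proof -
    have "(2 * of_nat j - of_nat m - a) * \<xi> = - a * \<xi> + of_nat (m - j) * (- \<xi>) + of_nat j * \<xi>"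
      using that by (simp add: of_nat_diff algebra_simps)
    hence "exp ((2 * of_nat j - of_nat m - a) * \<xi>) = exp (- a * \<xi>) * exp (- \<xi>) ^ (m - j) * exp \<xi> ^ j"
      by (simp only: exp_add exp_of_nat_mult)
    moreover have "(2 * sinh \<xi>) ^ m = (2 * sinh \<xi>) ^ (m - j) * (2 * sinh \<xi>) ^ j"
      using that by (simp only: le_add_diff_inverse2 flip: power_add)
    ultimately show ?thesis by (simp only: power_divide) (simp add: mult_ac)
  qed
  thus ?thesis
    unfolding exp_jacobi_def poly_jacobi_poly 1 jacobi_exp_sum_def sum_distrib_left sum_divide_distrib
    by (intro sum.cong) auto
qed

lemma jacobi_coeff_Suc_0:
  "of_nat (Suc m) * jacobi_coeff (Suc m) a (- a) 0 =
     (of_nat m + 1 - a) * jacobi_coeff m a (- a) 0"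
proof -
  have "- a + of_nat (Suc m) = - a + of_nat m + 1" by simp
  hence "of_nat (Suc m) * jacobi_coeff (Suc m) a (- a) 0 =
      (- a + of_nat m + 1) * ((- a + of_nat m) gchoose m)"
    by (simp only: jacobi_coeff_def gbinomial_0 diff_zero mult_1_left Suc_times_gbinomial)
  thus ?thesis by (simp add: jacobi_coeff_def algebra_simps)
qed

lemma jacobi_coeff_Suc_Suc:
  "of_nat (Suc m) * jacobi_coeff (Suc m) a (- a) (Suc m) =
     (of_nat m + 1 + a) * jacobi_coeff m a (- a) m"
proof -
  have "a + of_nat (Suc m) = a + of_nat m + 1" by simp
  hence "of_nat (Suc m) * jacobi_coeff (Suc m) a (- a) (Suc m) =
      (a + of_nat m + 1) * ((a + of_nat m) gchoose m)"
    by (simp only: jacobi_coeff_def gbinomial_0 diff_self_eq_0 mult_1_right Suc_times_gbinomial)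
  thus ?thesis by (simp add: jacobi_coeff_def algebra_simps)
qed

text \<open>The interior coefficients of the recurrence for the exponential sums; the two preceding
  lemmas are its ends. All binomials are reduced to rational multiples of one product
  \<open>P Q\<close>, after which the claim is a rational identity.\<close>

lemma jacobi_coeff_Suc:
  assumes "i < m"
  shows "of_nat (Suc m) * jacobi_coeff (Suc m) a (- a) (Suc i) =
           (3 * of_nat m + 1 - 2 * of_nat i + a) * jacobi_coeff m a (- a) i
           + (of_nat m + 1 + 2 * of_nat (Suc i) - a) * jacobi_coeff m a (- a) (Suc i)"
proof -
  obtain k where m: "m = i + 1 + k" using assms less_imp_add_positive[of i m]
    by (metis Suc_eq_plus1 add.assoc add_Suc_shift less_natE plus_1_eq_Suc)
  define x y :: complex where "x = of_nat i" and "y = of_nat k"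
  have nz: "x + 1 \<noteq> 0" "y + 1 \<noteq> 0"
    unfolding x_def y_def by (metis of_nat_Suc of_nat_neq_0 add.commute)+
  define P Q where "P = ((a + of_nat m) gchoose i)" and "Q = ((- a + of_nat m) gchoose k)"
  have M: "of_nat m = x + 1 + y" by (simp add: m x_def y_def)
  have Suc_eq: "of_nat (Suc i) = x + 1" "of_nat (Suc k) = y + 1"
    by (simp_all add: x_def y_def)
  define X Y where "X = ((a + of_nat m) gchoose Suc i)" and "Y = ((- a + of_nat m) gchoose Suc k)"
  have "(a + of_nat m) * P = x * P + (x + 1) * X" "(- a + of_nat m) * Q = y * Q + (y + 1) * Y"
    unfolding P_def Q_def X_def Y_def Suc_eq[symmetric] by (simp_all only: gbinomial_mult_1 x_def y_def)
  hence "X * (x + 1) = P * (a + y + 1)" "Y * (y + 1) = Q * (x + 1 - a)"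
    unfolding M by (simp_all add: algebra_simps)
  hence 1: "X = P * (a + y + 1) / (x + 1)" and 2: "Y = Q * (x + 1 - a) / (y + 1)"
    using nz by (simp_all only: nonzero_eq_divide_eq simp_thms)
  have "a + of_nat (Suc m) = a + of_nat m + 1" "- a + of_nat (Suc m) = - a + of_nat m + 1" by simp_all
  hence "(a + of_nat (Suc m)) gchoose (Suc i) = (a + of_nat m + 1) / (x + 1) * P"
    "(- a + of_nat (Suc m)) gchoose (Suc k) = (- a + of_nat m + 1) / (y + 1) * Q"
    by (simp_all only: gbinomial_factors P_def Q_def Suc_eq)
  hence 3: "(a + of_nat (Suc m)) gchoose (Suc i) = (a + x + y + 2) / (x + 1) * P"
    and 4: "(- a + of_nat (Suc m)) gchoose (Suc k) = (x + y + 2 - a) / (y + 1) * Q"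
    unfolding M by (simp_all add: add_ac)
  have "Suc m - Suc i = Suc k" "m - i = Suc k" "m - Suc i = k" by (simp_all add: m)
  hence B: "jacobi_coeff (Suc m) a (- a) (Suc i) = ((a + x + y + 2) / (x + 1) * P) * ((x + y + 2 - a) / (y + 1) * Q)"
    "jacobi_coeff m a (- a) i = P * (Q * (x + 1 - a) / (y + 1))"
    "jacobi_coeff m a (- a) (Suc i) = (P * (a + y + 1) / (x + 1)) * Q"
    unfolding jacobi_coeff_def
    by (simp_all only: 3 4 P_def[symmetric] Q_def[symmetric] X_def[symmetric] Y_def[symmetric] 1[symmetric] 2[symmetric])
  have "of_nat (Suc m) = x + y + 2" "of_nat (Suc i) = x + 1"
    by (simp_all add: m x_def y_def)
  thus ?thesis
    unfolding B M x_def[symmetric]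
    using nz by (simp only: ) (simp add: divide_simps, simp add: algebra_simps)
qed

text \<open>Each summand is \<open>2 (2m+1) cosh \<xi> e - 2 sinh \<xi> e'\<close> for the
  exponential \<open>e\<close> with exponent \<open>(2j - m - a) \<xi>\<close>. Every such
  \<open>e\<close> feeds the neighbouring exponents \<open>j\<close> and \<open>j + 1\<close> of the
  next sum, and regrouping leaves the coefficient recurrences.\<close>

lemma jacobi_exp_sum_Suc:
  "of_nat (Suc m) * jacobi_exp_sum (Suc m) a \<xi> =
     (\<Sum>j\<le>m. jacobi_coeff m a (- a) j *
        ((3 * of_nat m + 1 - 2 * of_nat j + a) * exp ((2 * of_nat j - of_nat m - a) * \<xi> + \<xi>)
         + (of_nat m + 1 + 2 * of_nat j - a) * exp ((2 * of_nat j - of_nat m - a) * \<xi> - \<xi>)))"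
proof -
  define E where "E = (\<lambda>j::nat. exp ((2 * of_nat j - of_nat (Suc m) - a) * \<xi>))"
  define b where "b = jacobi_coeff m a (- a)"
  define p q :: "nat \<Rightarrow> complex" where "p = (\<lambda>j. 3 * of_nat m + 1 - 2 * of_nat j + a)"
    and "q = (\<lambda>j. of_nat m + 1 + 2 * of_nat j - a)"
  have E: "exp ((2 * of_nat j - of_nat m - a) * \<xi> + \<xi>) = E (Suc j)"
    "exp ((2 * of_nat j - of_nat m - a) * \<xi> - \<xi>) = E j" for j
    by (simp_all add: E_def algebra_simps)
  have "of_nat (Suc m) * jacobi_exp_sum (Suc m) a \<xi> =
      (\<Sum>j\<le>Suc m. of_nat (Suc m) * jacobi_coeff (Suc m) a (- a) j * E j)"
    by (simp only: jacobi_exp_sum_def E_def sum_distrib_left mult.assoc)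
  also have "\<dots> = of_nat (Suc m) * jacobi_coeff (Suc m) a (- a) 0 * E 0 +
      (\<Sum>j<m. of_nat (Suc m) * jacobi_coeff (Suc m) a (- a) (Suc j) * E (Suc j)) +
      of_nat (Suc m) * jacobi_coeff (Suc m) a (- a) (Suc m) * E (Suc m)"
    by (simp only: sum.atMost_shift sum.lessThan_Suc add.assoc)
  also have "\<dots> = q 0 * b 0 * E 0 +
      (\<Sum>j<m. (p j * b j + q (Suc j) * b (Suc j)) * E (Suc j)) + p m * b m * E (Suc m)"
    unfolding jacobi_coeff_Suc_0 jacobi_coeff_Suc_Suc
    using jacobi_coeff_Suc[of _ m a] by (simp add: p_def q_def b_def del: of_nat_Suc)
  also have "\<dots> = (q 0 * b 0 * E 0 + (\<Sum>j<m. q (Suc j) * b (Suc j) * E (Suc j)))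
      + ((\<Sum>j<m. p j * b j * E (Suc j)) + p m * b m * E (Suc m))"
    by (simp add: ring_distribs sum.distrib)
  also have "\<dots> = (\<Sum>j\<le>m. q j * b j * E j) + (\<Sum>j\<le>m. p j * b j * E (Suc j))"
  proof -
    have "(\<Sum>j\<le>m. q j * b j * E j) = q 0 * b 0 * E 0 + (\<Sum>j<m. q (Suc j) * b (Suc j) * E (Suc j))"
      by (rule sum.atMost_shift)
    moreover have "(\<Sum>j\<le>m. p j * b j * E (Suc j)) = (\<Sum>j<m. p j * b j * E (Suc j)) + p m * b m * E (Suc m)"
      by (simp only: sum.lessThan_Suc flip: lessThan_Suc_atMost)
    ultimately show ?thesis by simp
  qed
  also have "\<dots> = (\<Sum>j\<le>m. b j * (p j * E (Suc j) + q j * E j))"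
    by (simp add: algebra_simps flip: sum.distrib)
  finally show ?thesis by (simp only: E b_def p_def q_def)
qed

lemma jacobi_exp_sum_has_field_derivative:
  "(jacobi_exp_sum m a has_field_derivative
     (\<Sum>j\<le>m. jacobi_coeff m a (- a) j * ((2 * of_nat j - of_nat m - a) *
        exp ((2 * of_nat j - of_nat m - a) * \<xi>)))) (at \<xi>)"
  unfolding jacobi_exp_sum_def[abs_def]
  by (auto intro!: derivative_eq_intros sum.cong simp: mult_ac)

text \<open>With numerator \<open>N\<close> over a power of \<open>2 sinh \<xi>\<close>, the
  recurrence for the quotients is equivalent to the equation labelled \<open>R\<close> for the
  numerators.\<close>

lemma exp_jacobi_has_field_derivative:
  assumes "sinh \<xi> \<noteq> 0"
  shows "(exp_jacobi m a has_field_derivative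
           of_nat (Suc m) * (cosh \<xi> / sinh \<xi> * exp_jacobi m a \<xi> - exp_jacobi (Suc m) a \<xi>)) (at \<xi>)"
proof -
  define N where "N = jacobi_exp_sum m a \<xi>"
  define N' where "N' = (\<Sum>j\<le>m. jacobi_coeff m a (- a) j * ((2 * of_nat j - of_nat m - a) *
        exp ((2 * of_nat j - of_nat m - a) * \<xi>)))"
  define R where "R = jacobi_exp_sum (Suc m) a \<xi>"
  define s c where "s = sinh \<xi>" and "c = cosh \<xi>"
  have s: "s \<noteq> 0" using assms by (simp add: s_def)
  have R: "of_nat (Suc m) * R = 2 * (2 * of_nat m + 1) * c * N - 2 * s * N'"
  proof -
    have "2 * (2 * of_nat m + 1) * c * N - 2 * s * N' =
        (\<Sum>j\<le>m. 2 * (2 * of_nat m + 1) * c * (jacobi_coeff m a (- a) j * exp ((2 * of_nat j - of_nat m - a) * \<xi>))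
          - 2 * s * (jacobi_coeff m a (- a) j * ((2 * of_nat j - of_nat m - a) *
        exp ((2 * of_nat j - of_nat m - a) * \<xi>))))"
      by (simp only: N_def jacobi_exp_sum_def N'_def sum_distrib_left sum_subtractf)
    also have "\<dots> = of_nat (Suc m) * R"
      unfolding R_def jacobi_exp_sum_Suc exp_add exp_diff
      by (intro sum.cong refl)
         (simp add: s_def c_def sinh_field_def cosh_field_def exp_minus field_simps)
    finally show ?thesis by simp
  qed
  \<comment> \<open>Written with \<open>c / s\<close> in place of the exponent \<open>m - 1\<close>,
    so that \<open>m = 0\<close> fits the same formula.\<close>
  have "((\<lambda>\<xi>. (2 * sinh \<xi>) ^ m) has_field_derivative of_nat m * (2 * s) ^ m * (c / s)) (at \<xi>)"
  proof -
    have "((\<lambda>\<xi>. 2 * sinh \<xi>) has_field_derivative 2 * c) (at \<xi>)"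
      unfolding c_def by (auto intro!: derivative_eq_intros)
    from DERIV_power[OF this, of m] show ?thesis
      by (rule DERIV_cong) (use s in \<open>cases m; simp add: s_def field_simps\<close>)
  qed
  from DERIV_divide[OF jacobi_exp_sum_has_field_derivative this]
  have "((\<lambda>\<xi>. jacobi_exp_sum m a \<xi> / (2 * sinh \<xi>) ^ m) has_field_derivative
      (N' * (2 * s) ^ m - N * (of_nat m * (2 * s) ^ m * (c / s))) / ((2 * s) ^ m * (2 * s) ^ m)) (at \<xi>)"
    using assms by (simp add: N_def N'_def s_def c_def)
  moreover have "(N' * (2 * s) ^ m - N * (of_nat m * (2 * s) ^ m * (c / s))) / ((2 * s) ^ m * (2 * s) ^ m)
      = (N' - of_nat m * N * c / s) / (2 * s) ^ m"
    using s by (simp add: field_simps)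
  moreover have "\<dots> = (of_nat (Suc m) * (c / s) * N - of_nat (Suc m) * R / (2 * s)) / (2 * s) ^ m"
    unfolding R using s by (simp add: field_simps)
  moreover have "\<dots> = of_nat (Suc m) * (cosh \<xi> / sinh \<xi> * exp_jacobi m a \<xi> - exp_jacobi (Suc m) a \<xi>)"
    using assms by (simp add: exp_jacobi_eq N_def R_def s_def c_def algebra_simps diff_divide_distrib add_divide_distrib)
  ultimately have "((\<lambda>\<xi>. jacobi_exp_sum m a \<xi> / (2 * sinh \<xi>) ^ m) has_field_derivative
      of_nat (Suc m) * (cosh \<xi> / sinh \<xi> * exp_jacobi m a \<xi> - exp_jacobi (Suc m) a \<xi>)) (at \<xi>)"
    by (simp only:)
  moreover have "open {\<xi> :: complex. sinh \<xi> \<noteq> 0}"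
    by (intro open_Collect_neq continuous_intros)
  ultimately show ?thesis
    by (rule has_field_derivative_transform_within_open) (use assms in \<open>auto simp: exp_jacobi_eq\<close>)
qed

subsection \<open>Closed forms for \<open>c = 1/2 - m\<close> and \<open>c = 3/2 + m\<close>\<close>

text \<open>The coefficients of the recurrence do not involve the parameter \<open>a\<close>, so it
  passes to linear combinations over \<open>a\<close> and \<open>- a\<close>.\<close>

lemma even_part_exp_jacobi_has_field_derivative:
  assumes "sinh \<xi> \<noteq> 0"
  shows "((\<lambda>\<xi>. even_part (\<lambda>a. exp_jacobi m a \<xi>) \<alpha>) has_field_derivative
           of_nat (Suc m) * (cosh \<xi> / sinh \<xi> * even_part (\<lambda>a. exp_jacobi m a \<xi>) \<alpha>
             - even_part (\<lambda>a. exp_jacobi (Suc m) a \<xi>) \<alpha>)) (at \<xi>)"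
  unfolding even_part_def
  by (rule DERIV_cong[OF DERIV_cmult[OF DERIV_add[OF exp_jacobi_has_field_derivative[OF assms]
          exp_jacobi_has_field_derivative[OF assms]]]])
     (simp add: algebra_simps add_divide_distrib diff_divide_distrib)

lemma odd_part_exp_jacobi_has_field_derivative:
  assumes "sinh \<xi> \<noteq> 0"
  shows "((\<lambda>\<xi>. odd_part (\<lambda>a. exp_jacobi m a \<xi>) \<alpha>) has_field_derivative
           of_nat (Suc m) * (cosh \<xi> / sinh \<xi> * odd_part (\<lambda>a. exp_jacobi m a \<xi>) \<alpha>
             - odd_part (\<lambda>a. exp_jacobi (Suc m) a \<xi>) \<alpha>)) (at \<xi>)"
  unfolding odd_part_def
  by (rule DERIV_cong[OF DERIV_cmult[OF DERIV_diff[OF exp_jacobi_has_field_derivative[OF assms]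
          exp_jacobi_has_field_derivative[OF assms]]]])
     (simp add: algebra_simps add_divide_distrib diff_divide_distrib)

text \<open>An open set containing the positive reals on which \<open>sinh \<xi>\<close> has no
  zero; openness lets closed forms be differentiated during the inductions.\<close>

definition half_strip :: "complex set" where
  "half_strip = {\<xi>. 0 < Re \<xi> \<and> \<bar>Im \<xi>\<bar> < pi}"

lemma half_strip_imp_open_strip: "\<xi> \<in> half_strip \<Longrightarrow> \<xi> \<in> open_strip"
  by (simp add: half_strip_def open_strip_def)

lemma open_half_strip: "open half_strip"
  unfolding half_strip_def by (intro open_Collect_conj open_Collect_less continuous_intros)

lemma half_strip_nonzero:
  assumes "\<xi> \<in> half_strip"
  shows "sinh (\<xi> / 2) \<noteq> 0" "cosh (\<xi> / 2) \<noteq> 0" "sinh \<xi> = 2 * sinh (\<xi> / 2) * cosh (\<xi> / 2)" "sinh \<xi> \<noteq> 0"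
proof -
  show c: "cosh (\<xi> / 2) \<noteq> 0"
    using cosh_half_Re_pos[OF half_strip_imp_open_strip[OF assms]] by auto
  \<comment> \<open>A zero of \<open>sinh (\<xi> / 2)\<close> would force \<open>\<xi> = 0\<close>,
    by \<open>sinh_times_arsinh_quot\<close>.\<close>
  show s: "sinh (\<xi> / 2) \<noteq> 0"
    using sinh_times_arsinh_quot[OF half_strip_imp_open_strip[OF assms]] assms
    by (auto simp: half_strip_def)
  show eq: "sinh \<xi> = 2 * sinh (\<xi> / 2) * cosh (\<xi> / 2)"
    using sinh_double[of "\<xi> / 2"] by simp
  show "sinh \<xi> \<noteq> 0" unfolding eq using s c by simp
qed

text \<open>Chain rule with \<open>du/d\<xi> = - sinh(\<xi>/2) cosh(\<xi>/2)\<close>. It turns the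
  relations in \<open>u\<close> into relations in \<xi>.\<close>

lemma deriv_from_closed_form:
  assumes F: "F holomorphic_on gauss_domain"
    and eq: "\<And>\<xi>. \<xi> \<in> half_strip \<Longrightarrow> F (- (sinh (\<xi> / 2))\<^sup>2) = G \<xi>"
    and G: "(G has_field_derivative G') (at \<xi>)" and \<xi>: "\<xi> \<in> half_strip"
  shows "deriv F (- (sinh (\<xi> / 2))\<^sup>2) = - G' / (sinh (\<xi> / 2) * cosh (\<xi> / 2))"
proof -
  let ?s = "sinh (\<xi> / 2)" and ?c = "cosh (\<xi> / 2)"
  have "(F has_field_derivative deriv F (- ?s\<^sup>2)) (at (- ?s\<^sup>2))"
    using F gauss_domain_open gauss_domain_sinh_half(1)[OF half_strip_imp_open_strip[OF \<xi>]]
    by (rule holomorphic_derivI)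
  moreover have "((\<lambda>\<xi>. - (sinh (\<xi> / 2))\<^sup>2) has_field_derivative - ?s * ?c) (at \<xi>)"
    by (auto intro!: derivative_eq_intros)
  ultimately have "((\<lambda>\<xi>. F (- (sinh (\<xi> / 2))\<^sup>2)) has_field_derivative
      deriv F (- ?s\<^sup>2) * (- ?s * ?c)) (at \<xi>)"
    by (rule DERIV_chain2)
  hence "(G has_field_derivative deriv F (- ?s\<^sup>2) * (- ?s * ?c)) (at \<xi>)"
    using open_half_strip \<xi> by (rule has_field_derivative_transform_within_open) (rule eq)
  hence "G' = deriv F (- ?s\<^sup>2) * (- ?s * ?c)"
    using G DERIV_unique by blast
  thus ?thesis
    using half_strip_nonzero[OF \<xi>] by (simp add: field_simps)
qed

text \<open>
  The common shape of all closed forms at \<open>c = 1/2 + k\<close>: here \<open>k = - m\<close> in the \<open>+\<close> case and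
  \<open>k = m + 1\<close> in the \<open>-\<close> case.
\<close>

lemma closed_form_has_field_derivative:
  fixes A :: complex and k :: int
  assumes \<xi>: "\<xi> \<in> half_strip" and T: "(T has_field_derivative T') (at \<xi>)"
  defines "s \<equiv> sinh (\<xi> / 2)" and "c \<equiv> cosh (\<xi> / 2)"
  shows "((\<lambda>\<xi>. A * sinh (\<xi> / 2) powi (- k) * cosh (\<xi> / 2) powi (k - 1) * T \<xi>) has_field_derivative
           A * s powi (- k) * c powi (k - 1) *
             (T' + T \<xi> * (of_int (k - 1) / 2 * (s / c) - of_int k / 2 * (c / s)))) (at \<xi>)"
proof -
  note nz = half_strip_nonzero(1,2)[OF \<xi>]
  have "((\<lambda>\<xi>. sinh (\<xi> / 2)) has_field_derivative c / 2) (at \<xi>)"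
    "((\<lambda>\<xi>. cosh (\<xi> / 2)) has_field_derivative s / 2) (at \<xi>)"
    unfolding s_def c_def by (auto intro!: derivative_eq_intros)
  from DERIV_mult[OF DERIV_mult[OF DERIV_cmult[OF DERIV_power_int[OF this(1) disjI2[OF nz(1)], of "- k"], of A]
        DERIV_power_int[OF this(2) disjI2[OF nz(2)], of "k - 1"]] T]
  show ?thesis
  proof (rule DERIV_cong, fold s_def c_def)
    have "s powi (- k - 1) = s powi (- k) / s" "c powi (k - 1 - 1) = c powi (k - 1) / c"
      using nz power_int_diff[of s "- k" 1] power_int_diff[of c "k - 1" 1] by (simp_all add: s_def c_def)
    thus "((A * (of_int (- k) * s powi (- k - 1) * (c / 2))) * c powi (k - 1) +
        of_int (k - 1) * c powi (k - 1 - 1) * (s / 2) * (A * s powi (- k))) * T \<xi> +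
        T' * (A * s powi (- k) * c powi (k - 1)) =
        A * s powi (- k) * c powi (k - 1) *
             (T' + T \<xi> * (of_int (k - 1) / 2 * (s / c) - of_int k / 2 * (c / s)))"
      by (simp only:) (simp add: algebra_simps diff_divide_distrib)
  qed
qed

lemma coth_half:
  assumes "\<xi> \<in> half_strip"
  shows "cosh \<xi> / sinh \<xi> = (cosh (\<xi> / 2) / sinh (\<xi> / 2) + sinh (\<xi> / 2) / cosh (\<xi> / 2)) / 2"
  using half_strip_nonzero(1,2)[OF assms] cosh_double[of "\<xi> / 2"] sinh_double[of "\<xi> / 2"]
  by (simp add: divide_simps power2_eq_square)

section \<open>Lowering \<open>c\<close> to \<open>1/2 - m\<close>: the even part\<close>

primrec gauss_lowered :: "nat \<Rightarrow> complex \<Rightarrow> complex \<Rightarrow> complex" where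
  "gauss_lowered 0 \<alpha> = gauss_half \<alpha>"
| "gauss_lowered (Suc m) \<alpha> =
     (\<lambda>u. gauss_lowered m \<alpha> u + 1 / (1 / 2 - of_nat (Suc m)) * (u * deriv (gauss_lowered m \<alpha>) u))"

lemma half_minus_nat_notin_nonpos_Ints: "1 / 2 - of_nat k \<notin> (\<int>\<^sub>\<le>\<^sub>0 :: complex set)"
proof
  assume "1 / 2 - of_nat k \<in> (\<int>\<^sub>\<le>\<^sub>0 :: complex set)"
  then obtain n where "1 / 2 - of_nat k = - (of_nat n :: complex)" by (elim nonpos_Ints_cases')
  hence "1 / 2 - real k = - real n" by (simp add: complex_eq_iff)
  hence "real (1 + 2 * n) = real (2 * k)" by simp
  hence "1 + 2 * n = 2 * k" by (simp only: of_nat_eq_iff)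
  thus False by presburger
qed

lemma gauss_continuation_gauss_lowered:
  "gauss_continuation (1 / 2 - \<alpha>) (1 / 2 + \<alpha>) (1 / 2 - of_nat m) (gauss_lowered m \<alpha>)"
proof (induction m)
  case 0 thus ?case using gauss_continuation_gauss_half by simp
next
  case (Suc m)
  have eq: "1 / 2 - of_nat (Suc m) + (1 :: complex) = 1 / 2 - of_nat m" by simp
  have "gauss_continuation (1 / 2 - \<alpha>) (1 / 2 + \<alpha>) (1 / 2 - of_nat (Suc m) + 1) (gauss_lowered m \<alpha>)"
    unfolding eq by (rule Suc)
  from gauss_continuation_lower[OF this half_minus_nat_notin_nonpos_Ints]
  show ?case by (simp only: gauss_lowered.simps)
qed

lemma exp_jacobi_0: "exp_jacobi 0 a \<xi> = exp (- a * \<xi>)"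
  by (simp add: exp_jacobi_def poly_jacobi_poly jacobi_coeff_def)

text \<open>Induction with the lowering operator and the recurrence for the even part. The exponents
  keep the form of \<open>closed_form_has_field_derivative\<close> at
  \<open>k = - m\<close>.\<close>

lemma gauss_lowered_closed_form:
  assumes "\<xi> \<in> half_strip"
  shows "gauss_lowered m \<alpha> (- (sinh (\<xi> / 2))\<^sup>2) =
           fact m / pochhammer (1 / 2) m * sinh (\<xi> / 2) powi (- (- int m)) * cosh (\<xi> / 2) powi (- int m - 1)
             * even_part (\<lambda>a. exp_jacobi m a \<xi>) \<alpha>"
  using assms
proof (induction m arbitrary: \<xi>)
  case 0
  have "cosh (\<alpha> * \<xi>) = even_part (\<lambda>a. exp_jacobi 0 a \<xi>) \<alpha>"
    by (simp add: even_part_def exp_jacobi_0 cosh_field_def)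
  with gauss_half_cosh[OF half_strip_imp_open_strip[OF 0], of \<alpha>] show ?case
    by (simp add: power_int_minus field_simps power2_eq_square)
next
  case (Suc m)
  define s c where "s = sinh (\<xi> / 2)" and "c = cosh (\<xi> / 2)"
  define x :: complex where "x = of_nat m"
  define A :: complex where "A = fact m / pochhammer (1 / 2) m"
  define M where "M = s powi (- (- int m)) * c powi (- int m - 1)"
  define T R where "T = even_part (\<lambda>a. exp_jacobi m a \<xi>) \<alpha>"
    and "R = even_part (\<lambda>a. exp_jacobi (Suc m) a \<xi>) \<alpha>"
  have nz: "s \<noteq> 0" "c \<noteq> 0" using half_strip_nonzero[OF Suc.prems] by (auto simp: s_def c_def)
  have x: "1 / 2 + x \<noteq> 0"
    using half_plus_nat_notin_nonpos_Ints[of m] by (auto simp: x_def)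
  \<comment> \<open>Reshapes \<open>1/2 + x \<noteq> 0\<close> into the facts \<open>x'\<close> and
    \<open>x''\<close> used when clearing fractions below.\<close>
  have "1 + x * 2 = 2 * (1 / 2 + x)" "x * 2 - (- 1) = 2 * (1 / 2 + x)"
    by (simp_all add: ring_distribs)
  moreover from x have "2 * (1 / 2 + x) \<noteq> 0" by (metis mult_eq_0_iff zero_neq_numeral)
  ultimately have x': "1 + x * 2 \<noteq> 0" and "x * 2 - (- 1) \<noteq> 0"
    by (simp_all only: not_False_eq_True)
  hence x'': "- 1 \<noteq> x * 2" by (metis right_minus_eq)
  have hol: "gauss_lowered m \<alpha> holomorphic_on gauss_domain"
    using gauss_continuation_gauss_lowered[of \<alpha> m] by (simp add: gauss_continuation_def)
  have T': "((\<lambda>\<xi>. even_part (\<lambda>a. exp_jacobi m a \<xi>) \<alpha>) has_field_derivative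
      (x + 1) * ((c / s + s / c) / 2 * T - R)) (at \<xi>)"
    using even_part_exp_jacobi_has_field_derivative[OF half_strip_nonzero(4)[OF Suc.prems], of m \<alpha>]
    unfolding coth_half[OF Suc.prems] by (simp add: s_def c_def x_def T_def R_def add_ac)
  have D: "deriv (gauss_lowered m \<alpha>) (- s\<^sup>2) =
      - (A * M * ((x + 1) * ((c / s + s / c) / 2 * T - R)
          + T * ((- x - 1) / 2 * (s / c) - (- x) / 2 * (c / s)))) / (s * c)"
    using deriv_from_closed_form[OF hol Suc.IH closed_form_has_field_derivative[OF Suc.prems T'] Suc.prems]
    by (simp add: A_def M_def T_def x_def s_def c_def mult_ac)
  have "gauss_lowered (Suc m) \<alpha> (- s\<^sup>2) =
      A * M * T + 1 / (- 1 / 2 - x) * (- s\<^sup>2 * deriv (gauss_lowered m \<alpha>) (- s\<^sup>2))"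
    using Suc.IH[OF Suc.prems] by (simp add: A_def M_def T_def x_def s_def c_def mult_ac)
  \<comment> \<open>All multiples of \<open>T\<close> cancel: those with \<open>s / c\<close> among
    themselves, those with \<open>c / s\<close> against \<open>A * M * T\<close>.\<close>
  also have "\<dots> = A * ((x + 1) / (1 / 2 + x)) * (M * (s / c)) * R"
    unfolding D using nz x x' x'' by (simp add: divide_simps power2_eq_square) (simp add: algebra_simps)
  also have "A * ((x + 1) / (1 / 2 + x)) = fact (Suc m) / pochhammer (1 / 2) (Suc m)"
    by (simp add: A_def x_def pochhammer_Suc add_ac)
  also have "M * (s / c) = s powi (- (- int (Suc m))) * c powi (- int (Suc m) - 1)"
    using nz by (simp add: M_def power_int_diff power_int_add power_int_minus field_simps power2_eq_square)
  finally show ?case by (simp add: s_def c_def R_def mult_ac)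
qed

section \<open>Raising \<open>c\<close> to \<open>3/2 + m\<close>: the odd part\<close>

text \<open>The operator of \<open>gauss_continuation_raise\<close> at \<open>c = 1/2 + k\<close>,
  where \<open>c - a = k + \<alpha>\<close>, \<open>c - b = k - \<alpha>\<close> and
  \<open>a + b - c = 1/2 - k\<close>.\<close>

primrec gauss_raised :: "nat \<Rightarrow> complex \<Rightarrow> complex \<Rightarrow> complex" where
  "gauss_raised 0 \<alpha> = gauss_half \<alpha>"
| "gauss_raised (Suc k) \<alpha> =
     (\<lambda>u. (1 / 2 + of_nat k) / ((of_nat k + \<alpha>) * (of_nat k - \<alpha>)) *
        ((1 - u) * deriv (gauss_raised k \<alpha>) u - (1 / 2 - of_nat k) * gauss_raised k \<alpha> u))"

text \<open>The product gains one factor at each end. Up to sign, it thus collects the divisors of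
  the successive raising steps.\<close>

lemma pochhammer_symmetric_Suc:
  fixes \<alpha> :: complex
  shows "pochhammer (\<alpha> - of_nat (Suc m)) (2 * Suc m + 1) =
    - ((of_nat (Suc m) + \<alpha>) * (of_nat (Suc m) - \<alpha>)) * pochhammer (\<alpha> - of_nat m) (2 * m + 1)"
proof -
  have "pochhammer (\<alpha> - of_nat (Suc m)) (2 * Suc m + 1) =
      (\<alpha> - of_nat (Suc m)) * pochhammer (\<alpha> - of_nat (Suc m) + 1) (2 * m + 2)"
    by (simp only: pochhammer_rec flip: Suc_eq_plus1) (simp add: pochhammer_rec)
  also have "\<alpha> - of_nat (Suc m) + 1 = \<alpha> - of_nat m" by simp
  also have "pochhammer (\<alpha> - of_nat m) (2 * m + 2) =
      pochhammer (\<alpha> - of_nat m) (2 * m + 1) * (\<alpha> - of_nat m + of_nat (2 * m + 1))"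
    using pochhammer_Suc[of "\<alpha> - of_nat m" "2 * m + 1"] by simp
  finally show ?thesis by (simp add: algebra_simps)
qed

text \<open>The hypothesis says that \<open>k^2 - \<alpha>^2\<close> is nonzero for all
  \<open>k\<close> up to \<open>m\<close>, as the raising steps require.\<close>

lemma gauss_continuation_gauss_raised:
  assumes "pochhammer (\<alpha> - of_nat m) (2 * m + 1) \<noteq> 0"
  shows "gauss_continuation (1 / 2 - \<alpha>) (1 / 2 + \<alpha>) (1 / 2 + of_nat (Suc m)) (gauss_raised (Suc m) \<alpha>)"
  using assms
proof (induction m)
  case 0
  show ?case
    using gauss_continuation_raise[OF gauss_continuation_gauss_half, of \<alpha>]
      half_plus_nat_notin_nonpos_Ints[of 0] 0
    by (simp add: add_ac)
next
  case (Suc m)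
  let ?k = "of_nat (Suc m) :: complex"
  from Suc.prems have nz: "(?k + \<alpha>) * (?k - \<alpha>) \<noteq> 0" "pochhammer (\<alpha> - of_nat m) (2 * m + 1) \<noteq> 0"
    unfolding pochhammer_symmetric_Suc by auto
  have eq: "1 / 2 + ?k - (1 / 2 - \<alpha>) = ?k + \<alpha>" "1 / 2 + ?k - (1 / 2 + \<alpha>) = ?k - \<alpha>"
    "1 / 2 - \<alpha> + (1 / 2 + \<alpha>) - (1 / 2 + ?k) = 1 / 2 - ?k" "1 / 2 + ?k + 1 = 1 / 2 + of_nat (Suc (Suc m))"
    by (simp_all add: field_simps)
  show ?case
    using gauss_continuation_raise[OF Suc.IH[OF nz(2)] half_plus_nat_notin_nonpos_Ints, unfolded eq, OF nz(1)]
    by (simp only: gauss_raised.simps(2)[of "Suc m"])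
qed

text \<open>The first raising step differentiates cosh into sinh and so replaces the even part by
  the odd part; later steps follow the recurrence in \<open>m\<close>. Hence the induction starts at
  \<open>c = 3/2\<close>.\<close>

lemma gauss_raised_closed_form:
  assumes "pochhammer (\<alpha> - of_nat m) (2 * m + 1) \<noteq> 0" "\<xi> \<in> half_strip"
  shows "gauss_raised (Suc m) \<alpha> (- (sinh (\<xi> / 2))\<^sup>2) =
           (- 1) ^ Suc m * fact m * pochhammer (1 / 2) (Suc m) / pochhammer (\<alpha> - of_nat m) (2 * m + 1)
             * sinh (\<xi> / 2) powi (- int (Suc m)) * cosh (\<xi> / 2) powi (int (Suc m) - 1)
             * odd_part (\<lambda>a. exp_jacobi m a \<xi>) \<alpha>"
  using assms
proof (induction m arbitrary: \<xi>)
  case 0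
  define s c where "s = sinh (\<xi> / 2)" and "c = cosh (\<xi> / 2)"
  have nz: "s \<noteq> 0" "c \<noteq> 0" using half_strip_nonzero[OF 0(2)] by (auto simp: s_def c_def)
  have \<alpha>: "\<alpha> \<noteq> 0" using 0 by simp
  have 1: "1 + s\<^sup>2 = c\<^sup>2" by (simp add: s_def c_def cosh_square_eq)
  have "((\<lambda>\<xi>. cosh (\<alpha> * \<xi>) / cosh (\<xi> / 2)) has_field_derivative
      (\<alpha> * sinh (\<alpha> * \<xi>) * c - cosh (\<alpha> * \<xi>) * (s / 2)) / (c * c)) (at \<xi>)"
    using nz unfolding s_def c_def by (auto intro!: derivative_eq_intros)
  from deriv_from_closed_form[OF holomorphic_on_gauss_half gauss_half_cosh[OF half_strip_imp_open_strip] this 0(2)]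
  have D: "deriv (gauss_half \<alpha>) (- s\<^sup>2) =
      - ((\<alpha> * sinh (\<alpha> * \<xi>) * c - cosh (\<alpha> * \<xi>) * (s / 2)) / (c * c)) / (s * c)"
    by (simp add: s_def c_def)
  have "gauss_raised (Suc 0) \<alpha> (- s\<^sup>2) =
      - 1 / (2 * \<alpha>\<^sup>2) * (c\<^sup>2 * deriv (gauss_half \<alpha>) (- s\<^sup>2) - 1 / 2 * (cosh (\<alpha> * \<xi>) / c))"
    using gauss_half_cosh[OF half_strip_imp_open_strip[OF 0(2)], of \<alpha>]
    by (simp add: 1[unfolded power2_eq_square] power2_eq_square flip: s_def c_def)
  also have "\<dots> = sinh (\<alpha> * \<xi>) / (2 * \<alpha> * s)"
    unfolding D using nz \<alpha> by (simp add: field_simps power2_eq_square)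
  also have "sinh (\<alpha> * \<xi>) = - odd_part (\<lambda>a. exp_jacobi 0 a \<xi>) \<alpha>"
    by (simp add: odd_part_def exp_jacobi_0 sinh_field_def field_simps)
  finally show ?case by (simp add: power_int_minus s_def field_simps)
next
  case (Suc m)
  define s c where "s = sinh (\<xi> / 2)" and "c = cosh (\<xi> / 2)"
  define x :: complex where "x = of_nat m"
  define A where "A = (- 1) ^ Suc m * fact m * pochhammer (1 / 2) (Suc m) / pochhammer (\<alpha> - of_nat m) (2 * m + 1)"
  define M where "M = s powi (- int (Suc m)) * c powi (int (Suc m) - 1)"
  define T R where "T = odd_part (\<lambda>a. exp_jacobi m a \<xi>) \<alpha>"
    and "R = odd_part (\<lambda>a. exp_jacobi (Suc m) a \<xi>) \<alpha>"
  have nz: "s \<noteq> 0" "c \<noteq> 0" using half_strip_nonzero[OF Suc.prems(2)] by (auto simp: s_def c_def)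
  have 1: "1 + s\<^sup>2 = c\<^sup>2" by (simp add: s_def c_def cosh_square_eq)
  from Suc.prems(1) have q: "(x + 1 + \<alpha>) * (x + 1 - \<alpha>) \<noteq> 0" "pochhammer (\<alpha> - of_nat m) (2 * m + 1) \<noteq> 0"
    unfolding pochhammer_symmetric_Suc by (auto simp: x_def add_ac)
  have hol: "gauss_raised (Suc m) \<alpha> holomorphic_on gauss_domain"
    using gauss_continuation_gauss_raised[OF q(2)] by (simp add: gauss_continuation_def)
  have T': "((\<lambda>\<xi>. odd_part (\<lambda>a. exp_jacobi m a \<xi>) \<alpha>) has_field_derivative
      (x + 1) * ((c / s + s / c) / 2 * T - R)) (at \<xi>)"
    using odd_part_exp_jacobi_has_field_derivative[OF half_strip_nonzero(4)[OF Suc.prems(2)], of m \<alpha>]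
    unfolding coth_half[OF Suc.prems(2)] by (simp add: s_def c_def x_def T_def R_def add_ac)
  have D: "deriv (gauss_raised (Suc m) \<alpha>) (- s\<^sup>2) =
      - (A * M * ((x + 1) * ((c / s + s / c) / 2 * T - R)
          + T * (x / 2 * (s / c) - (x + 1) / 2 * (c / s)))) / (s * c)"
    using deriv_from_closed_form[OF hol Suc.IH[OF q(2)]
        closed_form_has_field_derivative[OF Suc.prems(2) T', where k = "int (Suc m)"] Suc.prems(2)]
    unfolding A_def M_def T_def x_def s_def c_def by (simp only: mult.assoc) simp
  have k: "of_nat (Suc m) = x + 1" by (simp add: x_def)
  have "gauss_raised (Suc (Suc m)) \<alpha> (- s\<^sup>2) =
      (1 / 2 + (x + 1)) / ((x + 1 + \<alpha>) * (x + 1 - \<alpha>)) *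
        (c\<^sup>2 * deriv (gauss_raised (Suc m) \<alpha>) (- s\<^sup>2) - (1 / 2 - (x + 1)) * (A * M * T))"
    unfolding gauss_raised.simps(2)[of "Suc m"] k using Suc.IH[OF q(2) Suc.prems(2)]
    by (simp only: A_def M_def T_def mult.assoc flip: s_def c_def) (simp add: 1)
  \<comment> \<open>Again all multiples of \<open>T\<close> cancel, and \<open>R\<close>
    remains.\<close>
  also have "\<dots> = A * (x + 1) * (1 / 2 + (x + 1)) / ((x + 1 + \<alpha>) * (x + 1 - \<alpha>)) * (M * (c / s)) * R"
    unfolding D using nz q(1) by (simp add: divide_simps power2_eq_square) (simp add: algebra_simps)
  also have "A * (x + 1) * (1 / 2 + (x + 1)) / ((x + 1 + \<alpha>) * (x + 1 - \<alpha>)) =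
      (- 1) ^ Suc (Suc m) * fact (Suc m) * pochhammer (1 / 2) (Suc (Suc m)) /
        pochhammer (\<alpha> - of_nat (Suc m)) (2 * Suc m + 1)"
    unfolding pochhammer_symmetric_Suc
    unfolding pochhammer_Suc[of _ "Suc m"] fact_Suc[of m] k A_def power_Suc[of _ "Suc m"]
    using q by (simp add: divide_simps del: power_Suc)
  also have "M * (c / s) = s powi (- int (Suc (Suc m))) * c powi (int (Suc (Suc m)) - 1)"
    using nz by (simp add: M_def power_int_diff power_int_add power_int_minus field_simps power2_eq_square)
  finally show ?case by (simp only: s_def c_def R_def mult.assoc)
qed

subsection \<open>The associated Legendre functions\<close>

text \<open>A second form of the continuation at \<open>c = 1/2 + k\<close>, valid for every
  \<alpha>. It supplies the continuity in \<alpha> where \<open>gauss_raised\<close> would divide by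
  zero.\<close>

primrec gauss_integrated :: "nat \<Rightarrow> complex \<Rightarrow> complex \<Rightarrow> complex" where
  "gauss_integrated 0 \<alpha> = gauss_half \<alpha>"
| "gauss_integrated (Suc k) \<alpha> = euler_integral k (gauss_integrated k \<alpha>)"

lemma gauss_continuation_gauss_integrated:
  "gauss_continuation (1 / 2 - \<alpha>) (1 / 2 + \<alpha>) (1 / 2 + of_nat k) (gauss_integrated k \<alpha>)"
proof (induction k)
  case 0 thus ?case using gauss_continuation_gauss_half by simp
next
  case (Suc k)
  from gauss_continuation_euler_integral[OF this] show ?case by (simp add: add_ac)
qed

lemma continuous_on_gauss_integrated:
  "continuous_on (UNIV \<times> gauss_domain) (\<lambda>(\<alpha>, u). gauss_integrated k \<alpha> u)"
  by (induction k) (auto intro: continuous_on_gauss_half continuous_on_euler_integral)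

lemma continuous_on_gauss_2F1_parameter:
  assumes "u \<in> gauss_domain"
  shows "continuous_on UNIV (\<lambda>\<alpha>. gauss_2F1 (1 / 2 - \<alpha>) (1 / 2 + \<alpha>) (1 / 2 + of_nat k) u)"
proof -
  have "continuous_on UNIV (\<lambda>\<alpha>. gauss_integrated k \<alpha> u)"
    by (rule continuous_on_compose2[OF continuous_on_gauss_integrated[of k], of UNIV "\<lambda>\<alpha>. (\<alpha>, u)", simplified])
       (use assms in \<open>auto intro!: continuous_intros\<close>)
  thus ?thesis
    by (simp add: gauss_2F1_eq[OF gauss_continuation_gauss_integrated assms])
qed

lemma sinh_of_real_complex: "sinh (complex_of_real x) = of_real (sinh x)"
  and cosh_of_real_complex: "cosh (complex_of_real x) = of_real (cosh x)"
  by (simp_all add: sinh_field_def cosh_field_def flip: exp_of_real)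

text \<open>For \<open>z = cosh \<xi>\<close>, \<open>(z + 1) / (z - 1)\<close> is the square of
  \<open>coth (\<xi> / 2)\<close>. It is positive and the order is real, so the complex power is a
  real one.\<close>

lemma legendre_P_cosh:
  fixes r \<xi> :: real
  assumes "0 < \<xi>"
  shows "legendre_P (- 1 / 2 + \<alpha>) (of_real r) (cosh \<xi>) =
    1 / Gamma (1 - of_real r) * of_real ((cosh (\<xi> / 2) / sinh (\<xi> / 2)) powr r) *
      gauss_2F1 (1 / 2 - \<alpha>) (1 / 2 + \<alpha>) (1 - of_real r) (- (sinh (of_real \<xi> / 2))\<^sup>2)"
proof -
  define s c where "s = sinh (\<xi> / 2)" and "c = cosh (\<xi> / 2)"
  have pos: "s > 0" "c > 0" using assms by (auto simp: s_def c_def cosh_real_pos)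
  have c2: "cosh \<xi> = 2 * c\<^sup>2 - 1"
    using cosh_double_cosh[of "\<xi> / 2"] by (simp add: c_def)
  have s2: "c\<^sup>2 = s\<^sup>2 + 1"
    by (simp add: s_def c_def cosh_square_eq)
  have "(cosh \<xi> + 1) / (cosh \<xi> - 1) = (c / s)\<^sup>2"
    using pos unfolding c2 by (simp add: s2 power_divide divide_simps)
  also have "\<dots> = (c / s) powr 2" using pos by simp
  finally have "((cosh \<xi> + 1) / (cosh \<xi> - 1)) powr (r / 2) = (c / s) powr r"
    by (simp add: powr_powr)
  moreover have "of_real ((cosh \<xi> + 1) / (cosh \<xi> - 1)) powr (of_real r / 2 :: complex) =
      of_real (((cosh \<xi> + 1) / (cosh \<xi> - 1)) powr (r / 2))"
    using assms cosh_real_ge_1[of \<xi>] by (subst powr_of_real[symmetric]) auto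
  moreover have "complex_of_real ((1 - cosh \<xi>) / 2) = - (sinh (of_real \<xi> / 2))\<^sup>2"
  proof -
    have "(1 - cosh \<xi>) / 2 = - s\<^sup>2" unfolding c2 by (simp add: s2)
    thus ?thesis by (simp only: s_def) (simp flip: sinh_of_real_complex)
  qed
  moreover have "- (- 1 / 2 + \<alpha>) = 1 / 2 - \<alpha>" "- 1 / 2 + \<alpha> + 1 = 1 / 2 + \<alpha>"
    by simp_all
  ultimately show ?thesis
    unfolding legendre_P_def by (simp only: s_def c_def)
qed

text \<open>The exponents of \<open>s\<close> and of \<open>c\<close> each add up to
  \<open>- 1/2\<close>, whatever \<open>k\<close> is; hence both signs of the order share the factor
  \<open>sinh \<xi> powr (- 1 / 2)\<close>.\<close>

lemma legendre_prefactor: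
  fixes s c :: real
  assumes "0 < s" "0 < c"
  shows "(c / s) powr (1 / 2 - of_int k) * s powi (- k) * c powi (k - 1) =
           sqrt 2 * (2 * s * c) powr (- 1 / 2)"
proof -
  have "s powi (- k) = s powr (- of_int k)" "c powi (k - 1) = c powr (of_int k - 1)"
    using assms powr_real_of_int'[of s "- k"] powr_real_of_int'[of c "k - 1"] by simp_all
  hence "(c / s) powr (1 / 2 - of_int k) * s powi (- k) * c powi (k - 1) =
      (c powr (1 / 2 - of_int k) * c powr (of_int k - 1)) *
      (s powr (- (1 / 2 - of_int k)) * s powr (- of_int k))"
    using assms by (simp add: powr_divide powr_minus field_simps)
  also have "\<dots> = c powr (- 1 / 2) * s powr (- 1 / 2)"
    by (simp flip: powr_add)
  \<comment> \<open>Inserts \<open>1 = sqrt 2 * 2 powr (- 1 / 2)\<close>, to complete the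
    duplication formula of sinh.\<close>
  also have "\<dots> = (sqrt 2 * 2 powr (- 1 / 2)) * (s powr (- 1 / 2) * c powr (- 1 / 2))"
    by (simp add: powr_minus powr_half_sqrt)
  also have "\<dots> = sqrt 2 * (2 * s * c) powr (- 1 / 2)"
    using assms by (simp add: powr_mult)
  finally show ?thesis .
qed

text \<open>Reversing the factors gives
  \<open>pochhammer (1 / 2 - m) m = (- 1) ^ m * pochhammer (1 / 2) m\<close>. This cancels the
  Pochhammer symbol of the closed form and leaves the sign in the theorem.\<close>

lemma Gamma_half_minus_nat:
  "Gamma (1 / 2 - of_nat m :: complex) * ((- 1) ^ m * pochhammer (1 / 2) m) = of_real (sqrt pi)"
proof -
  have "pochhammer (1 / 2 - of_nat m :: complex) m = (- 1) ^ m * pochhammer (1 / 2) m"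
    using pochhammer_minus[of "of_nat m - 1 / 2 :: complex" m] by simp
  moreover have "pochhammer (1 / 2 - of_nat m :: complex) m =
      Gamma (1 / 2 - of_nat m + of_nat m) / Gamma (1 / 2 - of_nat m)"
    by (rule pochhammer_Gamma) (rule half_minus_nat_notin_nonpos_Ints)
  moreover have "Gamma (1 / 2 - of_nat m :: complex) \<noteq> 0"
    using half_minus_nat_notin_nonpos_Ints[of m] by (simp add: Gamma_eq_zero_iff)
  ultimately show ?thesis
    by (simp add: Gamma_one_half_complex field_simps)
qed

lemma Gamma_half_plus_nat:
  "Gamma (1 / 2 + of_nat k :: complex) = of_real (sqrt pi) * pochhammer (1 / 2) k"
proof -
  have "1 / 2 \<notin> (\<int>\<^sub>\<le>\<^sub>0 :: complex set)"
    using half_plus_nat_notin_nonpos_Ints[of 0] by simp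
  from pochhammer_Gamma[OF this, of k] show ?thesis
    by (simp add: Gamma_one_half_complex)
qed

lemma of_real_in_half_strip: "0 < \<xi> \<Longrightarrow> complex_of_real \<xi> \<in> half_strip"
  by (simp add: half_strip_def)

lemma legendre_prefactor_complex:
  fixes \<xi> :: real
  assumes "0 < \<xi>"
  shows "complex_of_real ((cosh (\<xi> / 2) / sinh (\<xi> / 2)) powr (1 / 2 - of_int k)) *
      (sinh (of_real \<xi> / 2) powi (- k) * cosh (of_real \<xi> / 2) powi (k - 1)) =
    of_real (sqrt 2) * of_real (sinh \<xi> powr (- 1 / 2))"
proof -
  have "sinh \<xi> = 2 * sinh (\<xi> / 2) * cosh (\<xi> / 2)"
    using sinh_double[of "\<xi> / 2"] by simp
  moreover have "sinh (of_real \<xi> / 2 :: complex) = of_real (sinh (\<xi> / 2))"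
    "cosh (of_real \<xi> / 2 :: complex) = of_real (cosh (\<xi> / 2))"
    by (simp_all flip: sinh_of_real_complex cosh_of_real_complex)
  moreover have "sinh (\<xi> / 2) > 0" "cosh (\<xi> / 2) > 0"
    using assms by (auto simp: cosh_real_pos)
  note legendre_prefactor[OF this, of k]
  ultimately show ?thesis
    by (simp only: flip: of_real_power_int of_real_mult) (simp only: mult_ac)
qed

lemma sqrt_two_over_pi: "complex_of_real (sqrt (2 / pi)) = of_real (sqrt 2) / of_real (sqrt pi)"
  by (simp add: real_sqrt_divide)

lemma legendre_P_half_plus_nat:
  fixes \<xi> :: real
  assumes "0 < \<xi>"
  shows "legendre_P (- 1 / 2 + \<alpha>) (1 / 2 + of_nat m) (cosh \<xi>) =
       of_real (sqrt (2 / pi)) * fact m * (-1) ^ m * of_real (sinh \<xi> powr (- 1 / 2)) *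
       even_part (\<lambda>a. exp (- a * of_real \<xi>) *
         poly (jacobi_poly m a (- a)) (of_real (cosh \<xi> / sinh \<xi>))) \<alpha>"
proof -
  note strip = of_real_in_half_strip[OF assms]
  let ?T = "even_part (\<lambda>a. exp_jacobi m a (of_real \<xi>)) \<alpha>"
  let ?u = "- (sinh (of_real \<xi> / 2 :: complex))\<^sup>2"
  \<comment> \<open>The order is \<open>1/2 - k\<close> with \<open>k = - m\<close>, as
    \<open>legendre_prefactor_complex\<close> expects; the other sign corresponds to
    \<open>k = m + 1\<close>.\<close>
  have order: "1 / 2 + of_nat m = complex_of_real (1 / 2 - of_int (- int m))"
    "1 - complex_of_real (1 / 2 - of_int (- int m)) = 1 / 2 - of_nat m"
    by simp_all
  have T: "?T = even_part (\<lambda>a. exp (- a * of_real \<xi>) *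
      poly (jacobi_poly m a (- a)) (of_real (cosh \<xi> / sinh \<xi>))) \<alpha>"
    by (simp add: exp_jacobi_def flip: sinh_of_real_complex cosh_of_real_complex)
  have F: "gauss_2F1 (1 / 2 - \<alpha>) (1 / 2 + \<alpha>) (1 / 2 - of_nat m) ?u =
      fact m / pochhammer (1 / 2) m *
        (sinh (of_real \<xi> / 2) powi (- (- int m)) * cosh (of_real \<xi> / 2) powi (- int m - 1)) * ?T"
    by (simp only: gauss_2F1_eq[OF gauss_continuation_gauss_lowered
          gauss_domain_sinh_half(1)[OF half_strip_imp_open_strip[OF strip]]]
        gauss_lowered_closed_form[OF strip] mult.assoc)
  have nz: "pochhammer (1 / 2 :: complex) m \<noteq> 0" "Gamma (1 / 2 - of_nat m :: complex) \<noteq> 0"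
    "complex_of_real (sqrt pi) \<noteq> 0"
    using Gamma_half_minus_nat[of m] by auto
  have G: "1 / Gamma (1 / 2 - of_nat m :: complex) * (fact m / pochhammer (1 / 2) m) =
      fact m * (- 1) ^ m / of_real (sqrt pi)"
    using nz unfolding Gamma_half_minus_nat[of m, symmetric] by (simp add: field_simps)
  have "legendre_P (- 1 / 2 + \<alpha>) (1 / 2 + of_nat m) (cosh \<xi>) =
      (1 / Gamma (1 / 2 - of_nat m) * (fact m / pochhammer (1 / 2) m)) *
      (of_real ((cosh (\<xi> / 2) / sinh (\<xi> / 2)) powr (1 / 2 - of_int (- int m))) *
        (sinh (of_real \<xi> / 2) powi (- (- int m)) * cosh (of_real \<xi> / 2) powi (- int m - 1))) * ?T"
    unfolding order(1) legendre_P_cosh[OF assms] order(2) F by (simp only: mult_ac)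
  also have "\<dots> = fact m * (- 1) ^ m / of_real (sqrt pi) *
      (of_real (sqrt 2) * of_real (sinh \<xi> powr (- 1 / 2))) * ?T"
    by (simp only: G legendre_prefactor_complex[OF assms])
  finally show ?thesis
    unfolding sqrt_two_over_pi T[symmetric] by (simp add: mult_ac)
qed

lemma pochhammer_eq_0_iff_range:
  fixes \<alpha> :: complex
  shows "pochhammer (\<alpha> - of_nat m) (2 * m + 1) = 0 \<longleftrightarrow> \<alpha> \<in> of_int ` {- int m..int m}"
proof
  assume "pochhammer (\<alpha> - of_nat m) (2 * m + 1) = 0"
  then obtain k where "k < 2 * m + 1" "\<alpha> - of_nat m = - of_nat k"
    unfolding pochhammer_eq_0_iff by blast
  hence "\<alpha> = of_int (int m - int k)" "int m - int k \<in> {- int m..int m}"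
    by (auto simp: algebra_simps)
  thus "\<alpha> \<in> of_int ` {- int m..int m}" by blast
next
  assume "\<alpha> \<in> of_int ` {- int m..int m}"
  then obtain i where i: "\<alpha> = of_int i" "- int m \<le> i" "i \<le> int m" by auto
  hence "nat (int m - i) < 2 * m + 1" "\<alpha> - of_nat m = - of_nat (nat (int m - i))"
    by (auto simp: algebra_simps of_nat_nat)
  thus "pochhammer (\<alpha> - of_nat m) (2 * m + 1) = 0"
    unfolding pochhammer_eq_0_iff by blast
qed

lemma legendre_P_cosh_minus:
  fixes \<xi> :: real
  assumes "0 < \<xi>"
  shows "legendre_P (- 1 / 2 + \<alpha>) (- (1 / 2 + of_nat m)) (cosh \<xi>) =
    1 / Gamma (1 / 2 + of_nat (Suc m)) *
      of_real ((cosh (\<xi> / 2) / sinh (\<xi> / 2)) powr (1 / 2 - of_int (int (Suc m)))) *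
      gauss_2F1 (1 / 2 - \<alpha>) (1 / 2 + \<alpha>) (1 / 2 + of_nat (Suc m)) (- (sinh (of_real \<xi> / 2))\<^sup>2)"
proof -
  have "- (1 / 2 + of_nat m) = complex_of_real (1 / 2 - of_int (int (Suc m)))"
    "1 - complex_of_real (1 / 2 - of_int (int (Suc m))) = 1 / 2 + of_nat (Suc m)"
    by simp_all
  thus ?thesis by (simp only: legendre_P_cosh[OF assms])
qed

lemma legendre_P_minus_half_minus_nat:
  fixes \<xi> :: real
  assumes "0 < \<xi>" and \<alpha>: "\<alpha> \<notin> of_int ` {- int m..int m}"
  shows "legendre_P (- 1 / 2 + \<alpha>) (- (1 / 2 + of_nat m)) (cosh \<xi>) =
       of_real (sqrt (2 / pi)) * fact m *
       ((-1) ^ (m + 1) / pochhammer (\<alpha> - of_nat m) (2 * m + 1)) *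
       of_real (sinh \<xi> powr (- 1 / 2)) *
       odd_part (\<lambda>a. exp (- a * of_real \<xi>) *
         poly (jacobi_poly m a (- a)) (of_real (cosh \<xi> / sinh \<xi>))) \<alpha>"
proof -
  note strip = of_real_in_half_strip[OF assms(1)]
  have p: "pochhammer (\<alpha> - of_nat m) (2 * m + 1) \<noteq> 0"
    using \<alpha> by (simp only: pochhammer_eq_0_iff_range not_False_eq_True)
  let ?p = "pochhammer (\<alpha> - of_nat m) (2 * m + 1)"
  let ?T = "odd_part (\<lambda>a. exp_jacobi m a (of_real \<xi>)) \<alpha>"
  let ?u = "- (sinh (of_real \<xi> / 2 :: complex))\<^sup>2"
  have T: "?T = odd_part (\<lambda>a. exp (- a * of_real \<xi>) *
      poly (jacobi_poly m a (- a)) (of_real (cosh \<xi> / sinh \<xi>))) \<alpha>"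
    by (simp add: exp_jacobi_def flip: sinh_of_real_complex cosh_of_real_complex)
  have F: "gauss_2F1 (1 / 2 - \<alpha>) (1 / 2 + \<alpha>) (1 / 2 + of_nat (Suc m)) ?u =
      (- 1) ^ Suc m * fact m * pochhammer (1 / 2) (Suc m) / ?p *
        (sinh (of_real \<xi> / 2) powi (- int (Suc m)) * cosh (of_real \<xi> / 2) powi (int (Suc m) - 1)) * ?T"
    by (simp only: gauss_2F1_eq[OF gauss_continuation_gauss_raised[OF p]
          gauss_domain_sinh_half(1)[OF half_strip_imp_open_strip[OF strip]]]
        gauss_raised_closed_form[OF p strip] mult.assoc)
  have "Gamma (1 / 2 + of_nat (Suc m) :: complex) \<noteq> 0"
    using half_plus_nat_notin_nonpos_Ints[of "Suc m"] by (simp only: Gamma_eq_zero_iff not_False_eq_True)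
  hence "pochhammer (1 / 2 :: complex) (Suc m) \<noteq> 0"
    unfolding Gamma_half_plus_nat by auto
  hence G: "1 / Gamma (1 / 2 + of_nat (Suc m) :: complex) *
      ((- 1) ^ Suc m * fact m * pochhammer (1 / 2) (Suc m) / ?p) =
      fact m * ((- 1) ^ (m + 1) / ?p) / of_real (sqrt pi)"
    unfolding Gamma_half_plus_nat using p by (simp add: divide_simps)
  have "legendre_P (- 1 / 2 + \<alpha>) (- (1 / 2 + of_nat m)) (cosh \<xi>) =
      (1 / Gamma (1 / 2 + of_nat (Suc m)) *
        ((- 1) ^ Suc m * fact m * pochhammer (1 / 2) (Suc m) / ?p)) *
      (of_real ((cosh (\<xi> / 2) / sinh (\<xi> / 2)) powr (1 / 2 - of_int (int (Suc m)))) *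
        (sinh (of_real \<xi> / 2) powi (- int (Suc m)) * cosh (of_real \<xi> / 2) powi (int (Suc m) - 1))) * ?T"
    unfolding legendre_P_cosh_minus[OF assms(1)] F by (simp only: mult_ac)
  also have "\<dots> = fact m * ((- 1) ^ (m + 1) / ?p) / of_real (sqrt pi) *
      (of_real (sqrt 2) * of_real (sinh \<xi> powr (- 1 / 2))) * ?T"
    by (simp only: G legendre_prefactor_complex[OF assms(1)])
  finally show ?thesis
    unfolding sqrt_two_over_pi T[symmetric] by (simp only: divide_inverse mult_ac)
qed

lemma isCont_legendre_P_degree:
  fixes \<xi> :: real
  assumes "0 < \<xi>"
  shows "isCont (\<lambda>\<alpha>. legendre_P (- 1 / 2 + \<alpha>) (- (1 / 2 + of_nat m)) (cosh \<xi>)) \<alpha>"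
proof -
  have "continuous_on UNIV (\<lambda>\<alpha>. legendre_P (- 1 / 2 + \<alpha>) (- (1 / 2 + of_nat m)) (cosh \<xi>))"
    unfolding legendre_P_cosh_minus[OF assms]
    by (intro continuous_on_mult_left continuous_on_gauss_2F1_parameter gauss_domain_sinh_half(1)
        half_strip_imp_open_strip of_real_in_half_strip assms)
  thus ?thesis by (simp add: continuous_on_eq_continuous_at)
qed

text \<open>In a punctured neighbourhood of \<alpha> the closed form holds, as the exceptional
  values are finitely many; continuity in the degree then identifies the limit.\<close>

lemma tendsto_legendre_P_minus_half_minus_nat:
  fixes \<xi> :: real
  assumes "0 < \<xi>"
  shows "((\<lambda>\<alpha>. of_real (sqrt (2 / pi)) * fact m *
       ((-1) ^ (m + 1) / pochhammer (\<alpha> - of_nat m) (2 * m + 1)) *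
       of_real (sinh \<xi> powr (- 1 / 2)) *
       odd_part (\<lambda>a. exp (- a * of_real \<xi>) *
         poly (jacobi_poly m a (- a)) (of_real (cosh \<xi> / sinh \<xi>))) \<alpha>)
     \<longlongrightarrow> legendre_P (- 1 / 2 + \<alpha>) (- (1 / 2 + of_nat m)) (cosh \<xi>)) (at \<alpha>)"
proof (rule Lim_transform_eventually)
  show "((\<lambda>\<alpha>. legendre_P (- 1 / 2 + \<alpha>) (- (1 / 2 + of_nat m)) (cosh \<xi>)) \<longlongrightarrow>
      legendre_P (- 1 / 2 + \<alpha>) (- (1 / 2 + of_nat m)) (cosh \<xi>)) (at \<alpha>)"
    using isCont_legendre_P_degree[OF assms] unfolding isCont_def .
  \<comment> \<open>The exceptional values other than \<alpha>: a finite, hence closed set that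
    \<alpha> avoids.\<close>
  let ?S = "complex_of_int ` {- int m..int m} - {\<alpha>}"
  have "open (- ?S)" by (intro open_Compl finite_imp_closed) auto
  hence "eventually (\<lambda>a. a \<in> - ?S) (at \<alpha>)"
    by (rule eventually_at_in_open') auto
  moreover have "eventually (\<lambda>a. a \<noteq> \<alpha>) (at \<alpha>)"
    by (rule eventually_neq_at_within)
  ultimately show "eventually (\<lambda>\<alpha>. legendre_P (- 1 / 2 + \<alpha>) (- (1 / 2 + of_nat m)) (cosh \<xi>) =
      of_real (sqrt (2 / pi)) * fact m *
       ((-1) ^ (m + 1) / pochhammer (\<alpha> - of_nat m) (2 * m + 1)) *
       of_real (sinh \<xi> powr (- 1 / 2)) *
       odd_part (\<lambda>a. exp (- a * of_real \<xi>) *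
         poly (jacobi_poly m a (- a)) (of_real (cosh \<xi> / sinh \<xi>))) \<alpha>) (at \<alpha>)"
    by eventually_elim (rule legendre_P_minus_half_minus_nat[OF assms], blast)
qed

theorem theorem8p4:
  fixes m :: nat and \<alpha> :: complex and z \<xi> :: real
  assumes "1 < z" and "0 < \<xi>"
  shows
    "legendre_P (- 1 / 2 + \<alpha>) (1 / 2 + of_nat m) z =
       of_real (sqrt (2 / pi)) * fact m * (-1) ^ m * of_real ((z\<^sup>2 - 1) powr (- 1 / 4)) *
       even_part (\<lambda>a. of_real (z + sqrt (z\<^sup>2 - 1)) powr (- a) *
         poly (jacobi_poly m a (- a)) (of_real (z / sqrt (z\<^sup>2 - 1)))) \<alpha>
     \<and> (let R = (\<lambda>\<alpha>'. of_real (sqrt (2 / pi)) * fact m *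
              ((-1) ^ (m + 1) / pochhammer (\<alpha>' - of_nat m) (2 * m + 1)) *
              of_real ((z\<^sup>2 - 1) powr (- 1 / 4)) *
              odd_part (\<lambda>a. of_real (z + sqrt (z\<^sup>2 - 1)) powr (- a) *
                poly (jacobi_poly m a (- a)) (of_real (z / sqrt (z\<^sup>2 - 1)))) \<alpha>')
        in if \<alpha> \<in> of_int ` {- int m..int m}
           then (R \<longlongrightarrow> legendre_P (- 1 / 2 + \<alpha>) (- (1 / 2 + of_nat m)) z) (at \<alpha>)
           else legendre_P (- 1 / 2 + \<alpha>) (- (1 / 2 + of_nat m)) z = R \<alpha>)
     \<and> legendre_P (- 1 / 2 + \<alpha>) (1 / 2 + of_nat m) (cosh \<xi>) =
       of_real (sqrt (2 / pi)) * fact m * (-1) ^ m * of_real (sinh \<xi> powr (- 1 / 2)) *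
       even_part (\<lambda>a. exp (- a * of_real \<xi>) *
         poly (jacobi_poly m a (- a)) (of_real (cosh \<xi> / sinh \<xi>))) \<alpha>
     \<and> (let R = (\<lambda>\<alpha>'. of_real (sqrt (2 / pi)) * fact m *
              ((-1) ^ (m + 1) / pochhammer (\<alpha>' - of_nat m) (2 * m + 1)) *
              of_real (sinh \<xi> powr (- 1 / 2)) *
              odd_part (\<lambda>a. exp (- a * of_real \<xi>) *
                poly (jacobi_poly m a (- a)) (of_real (cosh \<xi> / sinh \<xi>))) \<alpha>')
        in if \<alpha> \<in> of_int ` {- int m..int m}
           then (R \<longlongrightarrow> legendre_P (- 1 / 2 + \<alpha>) (- (1 / 2 + of_nat m)) (cosh \<xi>)) (at \<alpha>)
           else legendre_P (- 1 / 2 + \<alpha>) (- (1 / 2 + of_nat m)) (cosh \<xi>) = R \<alpha>)"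
proof -
  \<comment> \<open>With \<open>z = cosh \<eta>\<close> one has
    \<open>sqrt (z^2 - 1) = sinh \<eta>\<close> and \<open>z + sqrt (z^2 - 1) = exp \<eta>\<close>,
    so the formulas in \<open>z\<close> are those in \<xi> taken at \<eta>.\<close>
  define \<eta> where "\<eta> = arcosh z"
  have \<eta>: "0 < \<eta>" "z = cosh \<eta>"
    using assms(1) arcosh_nonneg_real[of z] arcosh_eq_0_iff_real[of z] by (auto simp: \<eta>_def)
  have pos: "sinh \<eta> > 0" using \<eta> by simp
  have sq: "z\<^sup>2 - 1 = (sinh \<eta>)\<^sup>2" by (simp add: \<eta>(2) cosh_square_eq)
  have sqrt_eq: "sqrt (z\<^sup>2 - 1) = sinh \<eta>" using pos by (simp add: sq)
  have "(z\<^sup>2 - 1) powr (- 1 / 4) = (sinh \<eta> powr 2) powr (- 1 / 4)"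
    using pos by (simp add: sq)
  hence powr_eq: "(z\<^sup>2 - 1) powr (- 1 / 4) = sinh \<eta> powr (- 1 / 2)"
    by (simp add: powr_powr)
  have "z + sinh \<eta> = exp \<eta>" by (simp add: \<eta>(2) cosh_plus_sinh)
  hence exp_eq: "complex_of_real (z + sinh \<eta>) powr (- a) = exp (- a * of_real \<eta>)" for a
    by (simp add: powr_def Ln_of_real)
  show ?thesis
    unfolding sqrt_eq powr_eq exp_eq Let_def if_bool_eq_conj unfolding \<eta>(2)
    by (intro conjI impI legendre_P_half_plus_nat legendre_P_minus_half_minus_nat
        tendsto_legendre_P_minus_half_minus_nat \<eta>(1) assms(2))
qed

end
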